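(* Consider the linear regression model $\mathbf{Y}=\mathbf{X}\beta+\varepsilon$ with $\mathbf{X}$ an $n\times d$ design matrix, $\beta\in\mathbb{R}^d$, $\mathrm{E}[\varepsilon]=0$ and $\mathrm{Var}(\varepsilon)=\sigma^2I_n$, and let $\hat\beta_{LS}=(\mathbf{X}'\mathbf{X})^{-1}\mathbf{X}'\mathbf{Y}$ be the least squares estimator. Assume that $\Sigma_X=\lim_{n\rightarrow\infty}n^{-1}\mathbf{X}'\mathbf{X}$ exists and is invertible and that $\sqrt n(\hat\beta_{LS}-\beta)\overset{d}{\rightarrow}N(0,\sigma^2\Sigma_X^{-1})$. Let $c=(c_1,\dots,c_d)'$ be any fixed $d$-vector, let $(a_{nj})$ be $d$-vectors with positive components satisfying $\max_{1\le j\le d}a_{nj}\rightarrow0$ and $\sqrt n\min_{1\le j\le d}a_{nj}\rightarrow\infty$ as $n\rightarrow\infty$, and let $\tilde\beta_n(c)$ be the oracle Hodges' estimator derived from $\hat\beta_{LS}$ (defined in the context, with $V=\sigma^{-2}\Sigma_X$). Then, whatever is the true value of $\beta$: for any subset $b\subset\{1,\dots,d\}$ with complement $\bar b$, $\beta_{\bar b}=c_{\bar b}$ implies $$\lim_{n\rightarrow\infty}\Pr(\tilde\beta_{n,\bar b}(c)=\beta_{\bar b})=1,$$ and $$\sqrt n(\tilde\beta_n(c)-\beta)\overset{d}{\rightarrow}N\left(0,\begin{pmatrix}\sigma^2\Sigma_{b(\beta)b(\beta)}^{-1}&0\\0&0\end{pmatrix}\right),\qquad\text{where }\Sigma_{b(\beta)b(\beta)}=\lim_{n\rightarrow\infty}\frac1n\mathbf{X}_{b(\beta)}'\mathbf{X}_{b(\beta)},$$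 with components arranged with the indices in $b(\beta)=\{j:\beta_j\neq c_j\}$ first and those in $\bar b(\beta)=\{1,\dots,d\}\setminus b(\beta)$ last.
   Context: $\mathbf{X}_b$ denotes the submatrix of $\mathbf{X}$ consisting of the columns with indices in $b$. Write $\hat\beta_n=\hat\beta_{LS}$ with components $\hat\beta_{nj}$. Put $V=\sigma^{-2}\Sigma_X$; $\hat V^{-1}$ denotes any consistent estimator of $V^{-1}$, and $\hat V$ its inverse. For $b\subset\{1,\dots,d\}$ with complement $\bar b$, vectors are rearranged as $\beta=(\beta_b',\beta_{\bar b}')'$, $\hat\beta_n=(\hat\beta_{n,b}',\hat\beta_{n,\bar b}')'$, and $\hat V=\begin{pmatrix}\hat V_{bb}&\hat V_{b\bar b}\\\hat V_{\bar bb}&\hat V_{\bar b\bar b}\end{pmatrix}$ is partitioned correspondingly. For $\emptyset\neq b\neq\{1,\dots,d\}$ put $\check\beta_{n,b}=\hat\beta_{n,b}+\hat V_{bb}^{-1}\hat V_{b\bar b}(\hat\beta_{n,\bar b}-c_{\bar b})$. Oracle Hodges' estimator: let $b_n(c)=\{j:|\hat\beta_{nj}-c_j|>a_{nj}\}$ and $\bar b_n(c)=\{j:|\hat\beta_{nj}-c_j|\le a_{nj}\}$. Then $\tilde\beta_n(c)=\hat\beta_n$ if $b_n(c)=\{1,\dots,d\}$; $\tilde\beta_n(c)=c$ if $b_n(c)=\emptyset$; otherwise the subvector of $\tilde\beta_n(c)$ with indices in $b_n(c)$ is $\check\beta_{n,b}$ evaluated at $b=b_n(c)$ and the subvector with indices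 in $\bar b_n(c)$ is $c_{\bar b_n(c)}$. $\tilde\beta_{n,\bar b}(c)$ denotes the subvector of $\tilde\beta_n(c)$ with indices in $\bar b$. If $b(\beta)=\emptyset$ the limit law is the point mass at $0$. $\overset{d}{\rightarrow}$ is convergence in distribution. *)

theory Defs
  imports "HOL-Probability.Probability"
begin

section \<open>Convergence of random elements\<close>

text \<open>
  The \<open>n\<close>-th random element lives on its own probability space \<open>M n\<close>, so that triangular
  arrays are allowed. The library's weak convergence (\<open>weak_conv_m\<close>) is restricted to measures
  on the real line, hence the definition of convergence in distribution for random vectors below.
\<close>

definition converges_in_probability ::
    "(nat \<Rightarrow> 'w measure) \<Rightarrow> (nat \<Rightarrow> 'w \<Rightarrow> 'b::metric_space) \<Rightarrow> 'b \<Rightarrow> bool" where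
  "converges_in_probability M Z z \<longleftrightarrow>
     (\<forall>n. Z n \<in> borel_measurable (M n)) \<and>
     (\<forall>e>0. (\<lambda>n. measure (M n) {\<omega> \<in> space (M n). dist (Z n \<omega>) z > e}) \<longlonglongrightarrow> 0)"

definition converges_in_distribution ::
    "(nat \<Rightarrow> 'w measure) \<Rightarrow> (nat \<Rightarrow> 'w \<Rightarrow> 'b::euclidean_space) \<Rightarrow> 'b measure \<Rightarrow> bool" where
  "converges_in_distribution M Z \<mu> \<longleftrightarrow>
     (\<forall>n. Z n \<in> borel_measurable (M n)) \<and>
     (\<forall>f :: 'b \<Rightarrow> real. continuous_on UNIV f \<and> bounded (range f) \<longrightarrow>
        (\<lambda>n. \<integral>\<omega>. f (Z n \<omega>) \<partial>M n) \<longlonglongrightarrow> (\<integral>x. f x \<partial>\<mu>))"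

definition covariance :: "'w measure \<Rightarrow> ('w \<Rightarrow> real) \<Rightarrow> ('w \<Rightarrow> real) \<Rightarrow> real" where
  "covariance M f g =
     (\<integral>\<omega>. (f \<omega> - (\<integral>x. f x \<partial>M)) * (g \<omega> - (\<integral>x. g x \<partial>M)) \<partial>M)"


section \<open>Normal laws, possibly degenerate\<close>

text \<open>\<open>normal_law m v\<close> is the law N(m, v) on the real line for a variance \<open>v \<ge> 0\<close>.\<close>

definition normal_law :: "real \<Rightarrow> real \<Rightarrow> real measure" where
  "normal_law m v =
     (if v = 0 then return borel m else density lborel (\<lambda>x. ennreal (normal_density m (sqrt v) x)))"

text \<open>
  \<open>\<mu>\<close> is N(m, S) iff every linear functional \<open>t\<close> of it has law N(t'm, t'St). The covariance matrix
  may be singular; in particular N(m, 0) is the point mass at \<open>m\<close>.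
\<close>

definition is_multivariate_normal ::
    "real ^ 'd \<Rightarrow> real ^ 'd ^ 'd \<Rightarrow> (real ^ 'd) measure \<Rightarrow> bool" where
  "is_multivariate_normal m S \<mu> \<longleftrightarrow>
     prob_space \<mu> \<and> sets \<mu> = sets borel \<and>
     transpose S = S \<and> (\<forall>t. 0 \<le> t \<bullet> (S *v t)) \<and>
     (\<forall>t. distr \<mu> borel (\<lambda>x. t \<bullet> x) = normal_law (t \<bullet> m) (t \<bullet> (S *v t)))"

definition converges_to_normal ::
    "(nat \<Rightarrow> 'w measure) \<Rightarrow> (nat \<Rightarrow> 'w \<Rightarrow> real ^ 'd) \<Rightarrow> real ^ 'd \<Rightarrow> real ^ 'd ^ 'd \<Rightarrow> bool" where
  "converges_to_normal M Z m S \<longleftrightarrow>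
     (\<exists>\<mu>. is_multivariate_normal m S \<mu> \<and> converges_in_distribution M Z \<mu>)"


section \<open>Blocks of vectors and matrices\<close>

text \<open>
  Since the index sets \<open>b\<close> vary (and are even random), a block of a \<open>d \<times> d\<close> matrix is kept inside
  the full index type and padded with zeros: \<open>block b b' A\<close> represents the submatrix of \<open>A\<close> with
  row indices in \<open>b\<close> and column indices in \<open>b'\<close>. Products of blocks with matching inner index sets
  are then the ordinary matrix products.
\<close>

definition block :: "'d set \<Rightarrow> 'd set \<Rightarrow> real ^ 'd ^ 'd \<Rightarrow> real ^ 'd ^ 'd" where
  "block b b' A = (\<chi> i j. if i \<in> b \<and> j \<in> b' then A $ i $ j else 0)"

text \<open>
  \<open>block b b (mat 1)\<close> is the identity matrix of size \<open>b\<close>. The padded inverse \<open>block_inv b A\<close> of the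
  principal submatrix of \<open>A\<close> follows the pattern of the library's \<open>matrix_inv\<close>; like the
  latter it is some unspecified fixed matrix if that submatrix is singular. For \<open>b = {}\<close> it is the
  zero matrix.
\<close>

definition is_block_inverse :: "'d::finite set \<Rightarrow> real ^ 'd ^ 'd \<Rightarrow> real ^ 'd ^ 'd \<Rightarrow> bool" where
  "is_block_inverse b A B \<longleftrightarrow>
     block b b B = B \<and>
     block b b A ** B = block b b (mat 1) \<and> B ** block b b A = block b b (mat 1)"

definition block_invertible :: "'d::finite set \<Rightarrow> real ^ 'd ^ 'd \<Rightarrow> bool" where
  "block_invertible b A \<longleftrightarrow> (\<exists>B. is_block_inverse b A B)"

definition block_inv :: "'d::finite set \<Rightarrow> real ^ 'd ^ 'd \<Rightarrow> real ^ 'd ^ 'd" where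
  "block_inv b A = (SOME B. is_block_inverse b A B)"


section \<open>Least squares\<close>

text \<open>
  An \<open>n \<times> d\<close> design matrix, with \<open>n\<close> varying, is given by its rows \<open>x 0, \<dots>, x (n - 1)\<close>.
  \<open>gram n x\<close> is X'X, and \<open>select_columns b x\<close> is the submatrix of the columns with indices in \<open>b\<close>
  (again padded with zeros).
\<close>

definition gram :: "nat \<Rightarrow> (nat \<Rightarrow> real ^ 'd) \<Rightarrow> real ^ 'd ^ 'd" where
  "gram n x = (\<chi> j k. \<Sum>i<n. x i $ j * x i $ k)"

definition select_columns :: "'d set \<Rightarrow> (nat \<Rightarrow> real ^ 'd) \<Rightarrow> nat \<Rightarrow> real ^ 'd" where
  "select_columns b x i = (\<chi> j. if j \<in> b then x i $ j else 0)"

text \<open>If X'X is singular, which can happen for finitely many \<open>n\<close> only in the asymptotic setting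
  considered here, \<open>matrix_inv\<close> and hence the estimator takes an unspecified value.\<close>

definition least_squares :: "nat \<Rightarrow> (nat \<Rightarrow> real ^ 'd) \<Rightarrow> (nat \<Rightarrow> real) \<Rightarrow> real ^ 'd" where
  "least_squares n x y = matrix_inv (gram n x) *v (\<Sum>i<n. y i *\<^sub>R x i)"


section \<open>The oracle Hodges' estimator\<close>

text \<open>Only the components of \<open>beta_check V h c b\<close> with indices in \<open>b\<close> are meaningful.\<close>

definition beta_check ::
    "real ^ 'd ^ 'd \<Rightarrow> real ^ 'd \<Rightarrow> real ^ 'd \<Rightarrow> 'd::finite set \<Rightarrow> real ^ 'd" where
  "beta_check V h c b = h + block_inv b V *v (block b (- b) V *v (h - c))"

definition active_set :: "real ^ 'd \<Rightarrow> real ^ 'd \<Rightarrow> real ^ 'd \<Rightarrow> 'd set" where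
  "active_set h c a = {j. \<bar>h $ j - c $ j\<bar> > a $ j}"

definition oracle_hodges ::
    "real ^ 'd ^ 'd \<Rightarrow> real ^ 'd \<Rightarrow> real ^ 'd \<Rightarrow> real ^ 'd \<Rightarrow> real ^ 'd" where
  "oracle_hodges V h c a =
     (let b = active_set h c a in
      if b = UNIV then h
      else if b = {} then c
      else (\<chi> j. if j \<in> b then beta_check V h c b $ j else c $ j))"

end

theory Submission
  imports Defs
begin

text \<open>
  Put \<open>B = {j. \<beta>\<^sub>j \<noteq> c\<^sub>j}\<close> and let \<open>Z\<^sub>n\<close> be the scaled error of the least squares
  estimator. As \<open>Z\<^sub>n\<close> is tight while the thresholds tend to \<open>0\<close> more slowly than \<open>1 / sqrt n\<close>, the
  active set equals \<open>B\<close> with probability tending to \<open>1\<close>. On that event the oracle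
  estimator is \<open>c\<close> off \<open>B\<close>, and its scaled error is \<open>W(Vhat) Vhat Z\<^sub>n\<close>, where \<open>W(V)\<close> is
  the padded inverse of the \<open>B\<close>-block of \<open>V\<close>. Since \<open>W\<close> is continuous where it is defined,
  Slutsky's lemma gives the limit law of \<open>W V Z\<close> with \<open>Z\<close> distributed as \<open>N(0, V\<^sup>-\<^sup>1)\<close>, whose
  covariance \<open>W V V\<^sup>-\<^sup>1 V W\<close> collapses to \<open>W V W = W\<close>.
\<close>

section \<open>Matrix inverses\<close>

lemma matrix_inv_unique:
  fixes A :: "real ^ 'n ^ 'n"
  assumes "B ** A = mat 1"
  shows "matrix_inv A = B"
proof -
  have "A ** B = mat 1" using assms matrix_left_right_inverse by blast
  then have "A ** matrix_inv A = mat 1"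
    unfolding matrix_inv_def using assms by (rule someI2[of _ B, OF conjI]) auto
  then have "B ** (A ** matrix_inv A) = B" by simp
  then show ?thesis using assms by (simp add: matrix_mul_assoc)
qed

lemma matrix_inv_right:
  fixes A :: "real ^ 'n ^ 'n"
  assumes "invertible A"
  shows "A ** matrix_inv A = mat 1"
  using assms matrix_inv_unique unfolding invertible_def by blast

lemma matrix_inv_left:
  fixes A :: "real ^ 'n ^ 'n"
  assumes "invertible A"
  shows "matrix_inv A ** A = mat 1"
  using assms matrix_inv_unique unfolding invertible_def by blast

text \<open>No \<open>B\<close> qualifies, so the choice returns one and the same matrix for every
  singular \<open>A\<close>. With this constant default, \<open>matrix_inv\<close> is Borel
  measurable on the whole space: continuous on an open set and constant off it.\<close>

lemma matrix_inv_singular: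
  fixes A :: "real ^ 'n ^ 'n"
  assumes "\<not> invertible A"
  shows "matrix_inv A = (SOME B. False)"
proof -
  have "(\<lambda>B. A ** B = mat 1 \<and> B ** A = mat 1) = (\<lambda>B. False)"
    using assms unfolding invertible_def by blast
  then show ?thesis unfolding matrix_inv_def by simp
qed

text \<open>Column \<open>k\<close> of the inverse solves \<open>A *v x = axis k 1\<close>, so
  Cramer's rule gives its entries as quotients of determinants, from which continuity can be read
  off.\<close>

lemma matrix_inv_cramer:
  fixes A :: "real ^ 'n ^ 'n"
  assumes "invertible A"
  shows "matrix_inv A =
    (\<chi> i k. det (\<chi> r j. if j = i then (if r = k then 1 else 0) else A $ r $ j) / det A)"
proof -
  have "A *v (matrix_inv A *v axis k 1) = axis k 1" for k
    using assms by (simp add: matrix_vector_mul_assoc matrix_inv_right)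
  then have "matrix_inv A *v axis k 1 =
      (\<chi> i. det (\<chi> r j. if j = i then axis k 1 $ r else A $ r $ j) / det A)" for k
    using assms invertible_det_nz cramer by blast
  then have "matrix_inv A $ i $ k =
      det (\<chi> r j. if j = i then axis k 1 $ r else A $ r $ j) / det A" for i k
    using matrix_vector_mult_basis[of "matrix_inv A" k]
    by (metis (no_types, lifting) column_def vec_lambda_beta)
  moreover have "axis k 1 $ r = (if r = k then 1 else (0 :: real))" for r k :: 'n
    by (simp add: axis_def)
  ultimately show ?thesis
    by (simp add: vec_eq_iff cong: if_cong)
qed

lemma continuous_on_det [continuous_intros]:
  fixes f :: "'a::topological_space \<Rightarrow> real ^ 'n ^ 'n"
  assumes "continuous_on S f"
  shows "continuous_on S (\<lambda>x. det (f x))"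
  unfolding det_def by (intro continuous_intros assms)

lemma open_invertible: "open {A :: real ^ 'n ^ 'n. invertible A}"
proof -
  have "open {A :: real ^ 'n ^ 'n. det A \<noteq> 0}"
    by (intro open_Collect_neq continuous_intros)
  then show ?thesis by (simp add: invertible_det_nz)
qed

lemma continuous_on_cofactor:
  "continuous_on S (\<lambda>A :: real ^ 'n ^ 'n. det (\<chi> r j. if j = i then c r else A $ r $ j))"
proof -
  have "continuous_on S (\<lambda>A :: real ^ 'n ^ 'n. if j = i then c r else A $ r $ j)" for r j
    by (cases "j = i") (simp_all add: continuous_intros)
  then show ?thesis by (intro continuous_intros)
qed

lemma continuous_on_matrix_inv:
  "continuous_on {A :: real ^ 'n ^ 'n. invertible A} matrix_inv"
proof -
  have "continuous_on {A :: real ^ 'n ^ 'n. invertible A} (\<lambda>A. \<chi> i k.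
      det (\<chi> r j. if j = i then (if r = k then 1 else 0) else A $ r $ j) / det A)"
    by (intro continuous_intros continuous_on_cofactor) (auto simp: invertible_det_nz)
  then show ?thesis
    by (rule continuous_on_eq) (simp add: matrix_inv_cramer)
qed

lemma isCont_matrix_inv:
  fixes A :: "real ^ 'n ^ 'n"
  assumes "invertible A"
  shows "isCont matrix_inv A"
  using continuous_on_matrix_inv open_invertible assms
  by (metis continuous_on_eq_continuous_at mem_Collect_eq)

lemma borel_measurable_matrix_inv [measurable]:
  "(matrix_inv :: real ^ 'n ^ 'n \<Rightarrow> _) \<in> borel_measurable borel"
proof -
  let ?S = "{A :: real ^ 'n ^ 'n. invertible A}"
  have "(\<lambda>A. if A \<in> ?S then matrix_inv A else (SOME B. False)) \<in> borel_measurable borel"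
    by (intro borel_measurable_continuous_on_if continuous_on_matrix_inv continuous_on_const
        borel_open open_invertible)
  moreover have "(\<lambda>A. if A \<in> ?S then matrix_inv A else (SOME B. False)) = matrix_inv"
    by (auto simp: matrix_inv_singular)
  ultimately show ?thesis by simp
qed

section \<open>Boundedness of matrix products and linearity of blocks\<close>

lemma bounded_bilinear_matrix_vector_mult:
  "bounded_bilinear ((*v) :: real ^ 'm ^ 'n \<Rightarrow> _)"
  unfolding bilinear_conv_bounded_bilinear[symmetric] bilinear_def
  by (auto intro!: linearI simp: algebra_simps matrix_vector_mult_scaleR scaleR_matrix_vector_assoc)

lemma bounded_bilinear_matrix_matrix_mult:
  "bounded_bilinear ((**) :: real ^ 'm ^ 'n \<Rightarrow> real ^ 'k ^ 'm \<Rightarrow> _)"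
  unfolding bilinear_conv_bounded_bilinear[symmetric] bilinear_def
  by (auto intro!: linearI simp: matrix_matrix_mult_def vec_eq_iff algebra_simps sum.distrib sum_distrib_left)

lemma linear_block: "linear (block b b')"
  by (auto intro!: linearI simp: block_def vec_eq_iff)

section \<open>Inverses of principal blocks\<close>

lemmas matrix_mult_distribs =
  bounded_bilinear.add_left[OF bounded_bilinear_matrix_matrix_mult]
  bounded_bilinear.add_right[OF bounded_bilinear_matrix_matrix_mult]
  bounded_bilinear.diff_left[OF bounded_bilinear_matrix_matrix_mult]
  bounded_bilinear.diff_right[OF bounded_bilinear_matrix_matrix_mult]

abbreviation block_id :: "'d::finite set \<Rightarrow> real ^ 'd ^ 'd" where
  "block_id b \<equiv> block b b (mat 1)"

text \<open>With the test \<open>j = i\<close> outermost, the sums in matrix products collapse to a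
  single term by simplification.\<close>

lemma block_id_nth: "block_id b $ i $ j = (if j = i then (if i \<in> b then 1 else 0) else 0)"
  by (auto simp: block_def mat_def)

lemma block_id_mult: "(block_id b ** A) $ i $ j = (if i \<in> b then A $ i $ j else 0)"
  by (simp add: matrix_matrix_mult_def block_id_nth if_distrib[of "\<lambda>x. x * _"] cong: if_cong)

lemma mult_block_id: "(A ** block_id b) $ i $ j = (if j \<in> b then A $ i $ j else 0)"
proof -
  have "A $ i $ k * block_id b $ k $ j = (if k = j then (if j \<in> b then A $ i $ j else 0) else 0)" for k
    by (auto simp: block_id_nth)
  then show ?thesis by (simp add: matrix_matrix_mult_def)
qed

lemma block_id_mult_vec: "(block_id b *v x) $ i = (if i \<in> b then x $ i else 0)"
  by (simp add: matrix_vector_mult_def block_id_nth if_distrib[of "\<lambda>x. x * _"] cong: if_cong)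

text \<open>\<open>block_id b\<close> is the coordinate projection onto \<open>b\<close>. Blocks
  written as products with projections reduce to associativity and idempotence.\<close>

lemma block_eq_mult: "block b b' A = block_id b ** A ** block_id b'"
  unfolding vec_eq_iff mult_block_id block_id_mult by (simp add: block_def)

lemma block_id_idem: "block_id b ** block_id b = block_id b"
  by (simp add: vec_eq_iff block_id_mult block_id_nth)

text \<open>Moves the truncation from \<open>A\<close> to the projections, so that later
  computations can multiply by the full matrix \<open>A\<close>.\<close>

lemma is_block_inverse_iff:
  "is_block_inverse b A B \<longleftrightarrow> block_id b ** B = B \<and> B ** block_id b = B \<and>
     block_id b ** (A ** B) = block_id b \<and> B ** (A ** block_id b) = block_id b"
proof -
  let ?E = "block_id b"
  have *: "?E ** B = B \<and> B ** ?E = B" if "block b b B = B"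
  proof -
    have B: "B = ?E ** B ** ?E" using that block_eq_mult[of b b B] by simp
    have "?E ** (?E ** B ** ?E) = ?E ** B ** ?E" "?E ** B ** ?E ** ?E = ?E ** B ** ?E"
      by (simp_all add: matrix_mul_assoc block_id_idem)
        (simp_all add: matrix_mul_assoc[symmetric] block_id_idem)
    with B show ?thesis by simp
  qed
  have **: "block b b B = B" if "?E ** B = B" "B ** ?E = B"
    using that block_eq_mult[of b b B] by simp
  have "block b b A ** B = ?E ** (A ** B)" "B ** block b b A = B ** (A ** ?E)"
    if "?E ** B = B" "B ** ?E = B"
  proof -
    have "block b b A ** B = ?E ** (A ** (?E ** B))" "B ** block b b A = B ** ?E ** (A ** ?E)"
      unfolding block_eq_mult[of b b A] by (simp_all only: matrix_mul_assoc)
    with that show "block b b A ** B = ?E ** (A ** B)" "B ** block b b A = B ** (A ** ?E)"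
      by simp_all
  qed
  then show ?thesis
    unfolding is_block_inverse_def using * ** by auto
qed

text \<open>The usual argument \<open>B = B A B' = B'\<close>, with \<open>block_id b\<close> in the
  role of the unit.\<close>

lemma is_block_inverse_unique:
  assumes "is_block_inverse b A B" "is_block_inverse b A B'"
  shows "B = B'"
proof -
  have "B ** block_id b = B" "block_id b ** (A ** B') = block_id b"
    "block_id b ** B' = B'" "B ** (A ** block_id b) = block_id b"
    using assms is_block_inverse_iff by blast+
  note * = this
  have "B = B ** (block_id b ** (A ** B'))" by (simp add: *)
  also have "\<dots> = B ** (A ** (block_id b ** B'))"
    by (metis * matrix_mul_assoc)
  also have "\<dots> = B ** (A ** block_id b) ** B'" by (simp add: matrix_mul_assoc)
  finally show ?thesis by (simp add: *)
qed

lemma block_inv_eqI: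
  assumes "is_block_inverse b A B"
  shows "block_inv b A = B"
  unfolding block_inv_def using assms is_block_inverse_unique by blast

lemma is_block_inverse_block_inv:
  assumes "block_invertible b A"
  shows "is_block_inverse b A (block_inv b A)"
  using assms block_inv_eqI unfolding block_invertible_def by metis

text \<open>Together with uniqueness, this makes the block inverse of a symmetric matrix
  symmetric.\<close>

lemma is_block_inverse_transpose:
  assumes "is_block_inverse b A B"
  shows "is_block_inverse b (transpose A) (transpose B)"
proof -
  have "transpose (block b' b'' C) = block b'' b' (transpose C)" for b' b'' and C :: "real ^ 'a ^ 'a"
    by (auto simp: block_def transpose_def vec_eq_iff)
  then show ?thesis
    using assms unfolding is_block_inverse_def
    by (metis matrix_transpose_mul transpose_mat)
qed

text \<open>Filling up the principal submatrix with an identity matrix reduces block inverses to inverses.\<close>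

definition block_pad :: "'d::finite set \<Rightarrow> real ^ 'd ^ 'd \<Rightarrow> real ^ 'd ^ 'd" where
  "block_pad b A = block b b A + (mat 1 - block_id b)"

lemma block_id_block_pad:
  "block_id b ** block_pad b A = block b b A" "block_pad b A ** block_id b = block b b A"
  unfolding block_pad_def block_eq_mult[of b b A]
  by (simp_all add: matrix_mult_distribs block_id_idem matrix_mul_assoc)
    (simp add: matrix_mul_assoc[symmetric] block_id_idem)

text \<open>\<open>block_pad b A\<close> is block diagonal, acting on the coordinates in
  \<open>b\<close> and as the identity on the others, so the two diagonal blocks are inverted
  separately.\<close>

lemma block_pad_left_inverse:
  assumes "is_block_inverse b A B"
  shows "(B + (mat 1 - block_id b)) ** block_pad b A = mat 1"
proof -
  have "B ** block b b A = block_id b" "B ** block_id b = B"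
    using assms is_block_inverse_def is_block_inverse_iff by blast+
  moreover have "block_id b ** block b b A = block b b A"
    by (simp add: block_eq_mult[of b b A] matrix_mul_assoc block_id_idem)
  ultimately have *: "B ** block b b A = block_id b" "B ** block_id b = B"
    "block_id b ** block b b A = block b b A"
    by blast+
  show ?thesis
    unfolding block_pad_def by (simp add: matrix_mult_distribs block_id_idem *)
qed

lemma is_block_inverse_matrix_inv_block_pad:
  assumes "invertible (block_pad b A)"
  shows "is_block_inverse b A (matrix_inv (block_pad b A) ** block_id b)"
proof -
  let ?N = "block_pad b A" and ?P = "matrix_inv (block_pad b A)" and ?E = "block_id b"
  note P = matrix_inv_right[OF assms] matrix_inv_left[OF assms]
  have comm: "?E ** ?N = ?N ** ?E" by (simp add: block_id_block_pad)
  \<comment> \<open>What commutes with \<open>?N\<close> commutes with its inverse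
    \<open>?P\<close>.\<close>
  have "?P ** ?E = ?P ** (?E ** ?N) ** ?P"
    by (simp add: matrix_mul_assoc[symmetric] P)
  also have "\<dots> = ?E ** ?P"
    unfolding comm by (simp add: matrix_mul_assoc P)
  finally have PE: "?P ** ?E = ?E ** ?P" .
  have "block b b A ** (?P ** ?E) = ?E ** (?N ** ?P) ** ?E"
    unfolding block_id_block_pad(1)[of b A, symmetric] by (simp add: matrix_mul_assoc)
  then have "block b b A ** (?P ** ?E) = ?E" by (simp add: P block_id_idem)
  moreover have "?P ** ?E ** block b b A = ?E ** (?P ** ?N) ** ?E"
    unfolding block_id_block_pad(2)[of b A, symmetric] PE by (simp add: matrix_mul_assoc)
  then have "?P ** ?E ** block b b A = ?E" by (simp add: P block_id_idem)
  moreover have "block b b (?P ** ?E) = ?P ** ?E"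
    unfolding block_eq_mult[of b b "?P ** ?E"]
    by (simp add: matrix_mul_assoc[symmetric] block_id_idem)
      (simp add: PE matrix_mul_assoc block_id_idem)
  ultimately show ?thesis unfolding is_block_inverse_def by blast
qed

lemma block_invertible_iff: "block_invertible b A \<longleftrightarrow> invertible (block_pad b A)"
  using block_pad_left_inverse is_block_inverse_matrix_inv_block_pad
  unfolding block_invertible_def invertible_left_inverse by metis

lemma block_inv_eq_matrix_inv:
  assumes "invertible (block_pad b A)"
  shows "block_inv b A = matrix_inv (block_pad b A) ** block_id b"
  using assms is_block_inverse_matrix_inv_block_pad block_inv_eqI by blast

text \<open>Again a constant default value off the open set where the block is invertible, which
  gives measurability of \<open>block_inv b\<close>.\<close>

lemma block_inv_singular:
  assumes "\<not> invertible (block_pad b A)"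
  shows "block_inv b A = (SOME B. False)"
proof -
  have "is_block_inverse b A = (\<lambda>B. False)"
    using assms block_invertible_iff unfolding block_invertible_def by blast
  then show ?thesis unfolding block_inv_def by simp
qed

lemma continuous_on_block_pad: "continuous_on S (block_pad b)"
  unfolding block_pad_def
  by (intro continuous_intros linear_continuous_on) (simp add: linear_block linear_conv_bounded_linear[symmetric])

lemma open_block_invertible: "open {A. block_invertible b A}"
proof -
  have "open (block_pad b -` {A. invertible A})"
    by (intro open_vimage open_invertible continuous_on_block_pad)
  then show ?thesis by (simp add: vimage_def block_invertible_iff)
qed

lemmas continuous_on_matrix_mult [continuous_intros] =
  bounded_bilinear.continuous_on[OF bounded_bilinear_matrix_matrix_mult]

lemma continuous_on_block_inv: "continuous_on {A. block_invertible b A} (block_inv b)"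
proof -
  have "continuous_on {A. block_invertible b A} (\<lambda>A. matrix_inv (block_pad b A) ** block_id b)"
    by (intro continuous_intros continuous_on_compose2[OF continuous_on_matrix_inv continuous_on_block_pad])
      (auto simp: block_invertible_iff)
  then show ?thesis
    by (rule continuous_on_eq) (simp add: block_inv_eq_matrix_inv block_invertible_iff)
qed

lemma isCont_block_inv: "block_invertible b A \<Longrightarrow> isCont (block_inv b) A"
  using continuous_on_block_inv open_block_invertible
  by (metis continuous_on_eq_continuous_at mem_Collect_eq)

lemma borel_measurable_block_inv [measurable]: "block_inv b \<in> borel_measurable borel"
proof -
  let ?S = "{A. block_invertible b A}"
  have "(\<lambda>A. if A \<in> ?S then block_inv b A else (SOME B. False)) \<in> borel_measurable borel"
    by (intro borel_measurable_continuous_on_if continuous_on_block_inv continuous_on_const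
        borel_open open_block_invertible)
  moreover have "(\<lambda>A. if A \<in> ?S then block_inv b A else (SOME B. False)) = block_inv b"
    by (auto simp: block_inv_singular block_invertible_iff)
  ultimately show ?thesis by simp
qed

text \<open>A kernel vector \<open>x\<close> of the padded matrix is supported in \<open>b\<close>
  and killed by the block, so the quadratic form of \<open>A\<close> vanishes at
  \<open>x\<close>.\<close>

lemma block_invertible_pos_def:
  fixes A :: "real ^ 'd ^ 'd"
  assumes "\<And>x. x \<noteq> 0 \<Longrightarrow> x \<bullet> (A *v x) > 0"
  shows "block_invertible b A"
proof -
  have "x = 0" if "block_pad b A *v x = 0" for x
  proof -
    have 1: "block b b A *v x = 0"
      using that by (metis block_id_block_pad(1) matrix_vector_mul_assoc matrix_vector_mult_0_right)
    \<comment> \<open>The block part of the kernel equation is zero by the previous step, so the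
      complementary projection of \<open>x\<close> is zero as well.\<close>
    then have x: "block_id b *v x = x"
      using that unfolding block_pad_def by (simp add: algebra_simps)
    have "x \<bullet> (A *v x) = (\<Sum>i\<in>UNIV. x $ i * (A *v x) $ i)" by (simp add: inner_vec_def)
    also have "\<dots> = (\<Sum>i\<in>UNIV. x $ i * (block_id b *v (A *v x)) $ i)"
    proof (rule sum.cong[OF refl])
      fix i
      have "x $ i = (if i \<in> b then x $ i else 0)"
        using block_id_mult_vec[of b x i] x by simp
      then show "x $ i * (A *v x) $ i = x $ i * (block_id b *v (A *v x)) $ i"
        by (auto simp: block_id_mult_vec split: if_splits)
    qed
    also have "\<dots> = x \<bullet> (block b b A *v x)"
      unfolding block_eq_mult[of b b A] using x
      by (simp add: inner_vec_def matrix_vector_mul_assoc[symmetric])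
    finally show "x = 0" using 1 assms[of x] by fastforce
  qed
  then show ?thesis
    unfolding block_invertible_iff invertible_left_inverse matrix_left_invertible_ker by blast
qed

text \<open>If the quadratic form vanishes at \<open>x\<close>, then perturbing \<open>x\<close> in the direction \<open>- A x\<close>
  would make it negative.\<close>

lemma pos_semidef_invertible_pos_def:
  fixes A :: "real ^ 'n ^ 'n"
  assumes sym: "transpose A = A" and psd: "\<And>x. 0 \<le> x \<bullet> (A *v x)"
    and inv: "invertible A" and "x \<noteq> 0"
  shows "x \<bullet> (A *v x) > 0"
proof (rule ccontr)
  assume "\<not> ?thesis"
  with psd[of x] have 0: "x \<bullet> (A *v x) = 0" by linarith
  define y where "y = A *v x"
  have "y \<noteq> 0"
    using inv \<open>x \<noteq> 0\<close> unfolding y_def invertible_left_inverse matrix_left_invertible_ker by blast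
  \<comment> \<open>By symmetry, \<open>A\<close> moves to the left factor, where
    \<open>A *v x\<close> is \<open>y\<close>.\<close>
  have xy: "x \<bullet> (A *v y) = y \<bullet> y"
    by (metis dot_lmul_matrix sym transpose_matrix_vector y_def)
  define q where "q = y \<bullet> (A *v y)"
  have le: "2 * (y \<bullet> y) \<le> t * q" if "t > 0" for t
  proof -
    have "0 \<le> (x - t *\<^sub>R y) \<bullet> (A *v (x - t *\<^sub>R y))" by (rule psd)
    also have "\<dots> = t * (t * q - 2 * (y \<bullet> y))"
      unfolding q_def using 0 xy y_def
      by (simp add: algebra_simps inner_diff_left inner_diff_right matrix_vector_mult_scaleR)
    finally show ?thesis using that by (simp add: zero_le_mult_iff)
  qed
  have "y \<bullet> y > 0" using \<open>y \<noteq> 0\<close> by simp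
  \<comment> \<open>\<open>t = 1\<close> shows that \<open>q\<close> is positive; then
    \<open>t = (y \<bullet> y) / q\<close> turns \<open>le\<close> into
    \<open>2 * (y \<bullet> y) \<le> y \<bullet> y\<close>, which is absurd.\<close>
  with le[of 1] have "q > 0" by linarith
  with le[of "(y \<bullet> y) / q"] \<open>y \<bullet> y > 0\<close> show False by simp
qed

section \<open>The oracle map\<close>

lemma block_block: "block b b' (block b b' A) = block b b' A"
  by (simp add: block_def vec_eq_iff)

text \<open>\<open>is_block_inverse\<close> sees \<open>A\<close> only through
  \<open>block b b A\<close>, so both sides choose from the same predicate, in the singular case
  too.\<close>

lemma block_inv_block: "block_inv b (block b b A) = block_inv b A"
  by (simp only: block_inv_def is_block_inverse_def block_block)

lemma block_invertible_block: "block_invertible b (block b b A) \<longleftrightarrow> block_invertible b A"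
  by (simp only: block_invertible_def is_block_inverse_def block_block)

lemma block_scaleR: "block b b' (k *\<^sub>R A) = k *\<^sub>R block b b' A"
  by (simp add: block_def vec_eq_iff)

lemma scaleR_matrix_mult:
  fixes A :: "real ^ 'm ^ 'n" and B :: "real ^ 'k ^ 'm"
  shows "(r *\<^sub>R A) ** B = r *\<^sub>R (A ** B)" "A ** (r *\<^sub>R B) = r *\<^sub>R (A ** B)"
  using bounded_bilinear_matrix_matrix_mult
  by (rule bounded_bilinear.scaleR_left, rule bounded_bilinear.scaleR_right)

lemma block_inv_scaleR:
  assumes "block_invertible b A" "k \<noteq> 0"
  shows "block_inv b (k *\<^sub>R A) = (1 / k) *\<^sub>R block_inv b A"
  using is_block_inverse_block_inv[OF assms(1)] assms(2)
  by (intro block_inv_eqI) (simp add: is_block_inverse_def block_scaleR scaleR_matrix_mult)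

text \<open>The linear map taking the scaled error of the full estimator to that of the oracle estimator.\<close>

definition oracle_map :: "'d::finite set \<Rightarrow> real ^ 'd ^ 'd \<Rightarrow> real ^ 'd ^ 'd" where
  "oracle_map b V = block_inv b V ** V"

text \<open>The rows of \<open>V\<close> in \<open>b\<close> split into the columns in
  \<open>b\<close>, which the block inverse turns into the identity, and the columns off
  \<open>b\<close>, which give the correction term of \<open>beta_check\<close>.\<close>

lemma oracle_map_eq:
  assumes "block_invertible b V"
  shows "oracle_map b V = block_id b + block_inv b V ** block b (- b) V"
proof -
  let ?W = "block_inv b V"
  have W: "?W ** block b b V = block_id b" "?W ** block_id b = ?W"
    using is_block_inverse_block_inv[OF assms] is_block_inverse_def is_block_inverse_iff by blast+
  have "block_id b ** V = block b b V + block b (- b) V"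
    unfolding vec_eq_iff block_id_mult by (simp add: block_def)
  then have "?W ** block_id b ** V = block_id b + ?W ** block b (- b) V"
    by (simp only: matrix_mul_assoc[symmetric]) (simp add: matrix_mult_distribs W)
  then show ?thesis by (simp add: oracle_map_def W)
qed

lemma oracle_map_nth_outside:
  assumes "block_invertible b V" "j \<notin> b"
  shows "(oracle_map b V *v x) $ j = 0"
proof -
  have "block_id b ** block_inv b V = block_inv b V"
    using is_block_inverse_block_inv[OF assms(1)] is_block_inverse_iff by blast
  then have "oracle_map b V *v x = block_id b *v (oracle_map b V *v x)"
    by (simp add: oracle_map_def matrix_vector_mul_assoc matrix_mul_assoc)
  then show ?thesis using assms(2) block_id_mult_vec[of b "oracle_map b V *v x" j] by simp
qed

text \<open>An exact identity once the active set is \<open>b\<close>. The correction term involves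
  only coordinates off \<open>b\<close>, where \<open>c\<close> may be replaced by
  \<open>\<beta>\<close>; the result is then \<open>oracle_map_eq\<close> applied to
  \<open>h - \<beta>\<close>.\<close>

lemma oracle_hodges_eq:
  assumes act: "active_set h c a = b" and inv: "block_invertible b V"
    and eq: "\<And>j. j \<notin> b \<Longrightarrow> \<beta> $ j = c $ j"
  shows "oracle_hodges V h c a - \<beta> = oracle_map b V *v (h - \<beta>)"
proof -
  have block: "block b (- b) V *v (h - c) = block b (- b) V *v (h - \<beta>)"
    using eq by (auto simp: block_def matrix_vector_mult_def vec_eq_iff intro!: sum.cong)
  have check: "(beta_check V h c b - \<beta>) $ j = (oracle_map b V *v (h - \<beta>)) $ j" if "j \<in> b" for j
    unfolding oracle_map_eq[OF inv] beta_check_def block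
    using that by (simp add: matrix_vector_mult_add_rdistrib block_id_mult_vec matrix_vector_mul_assoc)
  \<comment> \<open>For \<open>b = UNIV\<close> the correction vanishes and for
    \<open>b = {}\<close> no component is taken from \<open>beta_check\<close>, so the generic
    formula covers all three branches.\<close>
  have "block b (- b) V = 0" if "b = UNIV" using that by (simp add: block_def vec_eq_iff)
  then have "h = beta_check V h c b" if "b = UNIV" using that by (simp add: beta_check_def)
  then have "oracle_hodges V h c a $ j = (if j \<in> b then beta_check V h c b $ j else c $ j)" for j
    unfolding oracle_hodges_def act by (auto simp: Let_def)
  then show ?thesis
    using check eq oracle_map_nth_outside[OF inv] by (auto simp: vec_eq_iff)
qed

lemma oracle_hodges_nth_inactive:
  assumes "j \<notin> active_set h c a"
  shows "oracle_hodges V h c a $ j = c $ j"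
  using assms by (auto simp: oracle_hodges_def Let_def)

lemma isCont_oracle_map:
  assumes "block_invertible b V"
  shows "isCont (oracle_map b) V"
  unfolding oracle_map_def[abs_def]
  by (intro bounded_bilinear.isCont[OF bounded_bilinear_matrix_matrix_mult] isCont_block_inv assms) simp

lemma oracle_map_covariance:
  assumes sym: "transpose V = V" and inv: "invertible V" "block_invertible b V"
  shows "oracle_map b V ** matrix_inv V ** transpose (oracle_map b V) = block_inv b V"
proof -
  let ?W = "block_inv b V"
  note W = is_block_inverse_block_inv[OF inv(2)]
  have "transpose ?W = ?W"
    using is_block_inverse_transpose[OF W] W sym is_block_inverse_unique by metis
  then have T: "transpose (oracle_map b V) = V ** ?W"
    by (simp add: oracle_map_def matrix_transpose_mul sym)
  have "oracle_map b V ** matrix_inv V = ?W"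
    by (simp add: oracle_map_def matrix_mul_assoc[symmetric] matrix_inv_right[OF inv(1)])
  then have "oracle_map b V ** matrix_inv V ** transpose (oracle_map b V) = ?W ** (V ** ?W)"
    by (simp add: T)
  \<comment> \<open>The projection is inserted because only the rows of \<open>V ** ?W\<close> in
    \<open>b\<close> are known: there they form the identity.\<close>
  also have "\<dots> = ?W ** block_id b ** (V ** ?W)"
    using W is_block_inverse_iff[of b V ?W] by simp
  also have "\<dots> = ?W ** (block_id b ** (V ** ?W))"
    by (simp only: matrix_mul_assoc)
  also have "\<dots> = ?W"
    using W is_block_inverse_iff[of b V ?W] by simp
  finally show ?thesis .
qed

section \<open>Measurability of the oracle estimator\<close>

lemma borel_measurable_vec_lambda:
  fixes f :: "'i::finite \<Rightarrow> 'a \<Rightarrow> 'b::euclidean_space"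
  assumes "\<And>i. f i \<in> borel_measurable M"
  shows "(\<lambda>x. \<chi> i. f i x) \<in> borel_measurable M"
  using assms by (subst borel_measurable_euclidean_space) (auto simp: Basis_vec_def inner_axis)

lemma borel_measurable_matrix_vector_mult:
  fixes A :: "'a \<Rightarrow> real ^ 'm ^ 'n"
  assumes "A \<in> borel_measurable M" "f \<in> borel_measurable M"
  shows "(\<lambda>x. A x *v f x) \<in> borel_measurable M"
  by (rule borel_measurable_continuous_Pair[OF assms])
    (intro bounded_bilinear.continuous_on[OF bounded_bilinear_matrix_vector_mult] continuous_intros)

lemma borel_measurable_block:
  assumes "A \<in> borel_measurable M"
  shows "(\<lambda>x. block b b' (A x)) \<in> borel_measurable M"
proof -
  have "block b b' \<in> borel_measurable borel"
    by (intro borel_measurable_continuous_onI linear_continuous_on)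
      (simp add: linear_block linear_conv_bounded_linear[symmetric])
  with assms show ?thesis by (rule measurable_compose)
qed

lemma borel_measurable_vec_nth:
  fixes f :: "'a \<Rightarrow> 'b::euclidean_space ^ 'n"
  assumes "f \<in> borel_measurable M"
  shows "(\<lambda>x. f x $ i) \<in> borel_measurable M"
  by (intro borel_measurable_continuous_on[OF _ assms] continuous_intros)

text \<open>There are only finitely many index sets, so it suffices that each event that the active
  set equals a given \<open>b\<close> is measurable.\<close>

lemma measurable_active_set:
  assumes "h \<in> borel_measurable M"
  shows "(\<lambda>x. active_set (h x) c a) \<in> measurable M (count_space UNIV)"
proof (subst measurable_count_space_eq2_countable, safe)
  fix b
  have [measurable]: "(\<lambda>x. h x $ j) \<in> borel_measurable M" for j
    using assms by (rule borel_measurable_vec_nth)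
  have "{x \<in> space M. \<forall>j\<in>UNIV. a $ j < \<bar>h x $ j - c $ j\<bar> \<longleftrightarrow> j \<in> b} \<in> sets M"
    by measurable
  moreover have "(\<lambda>x. active_set (h x) c a) -` {b} \<inter> space M =
      {x \<in> space M. \<forall>j\<in>UNIV. a $ j < \<bar>h x $ j - c $ j\<bar> \<longleftrightarrow> j \<in> b}"
    by (auto simp: active_set_def)
  ultimately show "(\<lambda>x. active_set (h x) c a) -` {b} \<inter> space M \<in> sets M" by simp
qed (auto intro: countable_finite)

text \<open>For each fixed \<open>b\<close> the estimator formula is measurable; the random index
  set takes finitely many values, so substituting it preserves measurability.\<close>

lemma borel_measurable_oracle_hodges:
  assumes V: "V \<in> borel_measurable M" and h: "h \<in> borel_measurable M"
  shows "(\<lambda>x. oracle_hodges (V x) (h x) c a) \<in> borel_measurable M"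
proof -
  let ?F = "\<lambda>b x. if b = UNIV then h x else if b = {} then c
      else (\<chi> j. if j \<in> b then beta_check (V x) (h x) c b $ j else c $ j)"
  have "(\<lambda>x. beta_check (V x) (h x) c b) \<in> borel_measurable M" for b
    unfolding beta_check_def
    by (intro borel_measurable_add h borel_measurable_matrix_vector_mult borel_measurable_block V
        borel_measurable_diff measurable_const measurable_compose[OF V borel_measurable_block_inv]) simp
  note borel_measurable_vec_nth[OF this, measurable]
  have "?F b \<in> borel_measurable M" for b
  proof -
    have "(\<lambda>x. if j \<in> b then beta_check (V x) (h x) c b $ j else c $ j) \<in> borel_measurable M" for j
      by (cases "j \<in> b") simp_all
    note vec = borel_measurable_vec_lambda[OF this]
    consider "?F b = h" | "?F b = (\<lambda>x. c)"
      | "?F b = (\<lambda>x. \<chi> j. if j \<in> b then beta_check (V x) (h x) c b $ j else c $ j)"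
      by (cases "b = UNIV"; cases "b = {}") auto
    then show ?thesis by cases (simp_all only: h vec measurable_const space_borel UNIV_I)
  qed
  from measurable_compose_countable[of ?F, OF this measurable_active_set[OF h, of c a]]
  show ?thesis unfolding oracle_hodges_def Let_def .
qed

section \<open>Asymptotically negligible events and Slutsky's lemma\<close>

text \<open>Outer probability avoids measurability side conditions on \<open>E n\<close>.\<close>

definition vanishing :: "(nat \<Rightarrow> 'w measure) \<Rightarrow> (nat \<Rightarrow> 'w set) \<Rightarrow> bool" where
  "vanishing M E \<longleftrightarrow>
     (\<forall>e>0. \<forall>\<^sub>F n in sequentially. \<exists>F\<in>sets (M n). E n \<inter> space (M n) \<subseteq> F \<and> measure (M n) F < e)"

lemma vanishing_subset:
  assumes "vanishing M E" "\<forall>\<^sub>F n in sequentially. E' n \<inter> space (M n) \<subseteq> E n"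
  shows "vanishing M E'"
  unfolding vanishing_def
proof (intro allI impI)
  fix e :: real assume "e > 0"
  with assms(1) have "\<forall>\<^sub>F n in sequentially. \<exists>F\<in>sets (M n). E n \<inter> space (M n) \<subseteq> F \<and> measure (M n) F < e"
    unfolding vanishing_def by blast
  with assms(2) show "\<forall>\<^sub>F n in sequentially. \<exists>F\<in>sets (M n). E' n \<inter> space (M n) \<subseteq> F \<and> measure (M n) F < e"
    by eventually_elim blast
qed

lemma vanishing_Un:
  assumes prob: "\<And>n. prob_space (M n)" and "vanishing M E" "vanishing M E'"
  shows "vanishing M (\<lambda>n. E n \<union> E' n)"
  unfolding vanishing_def
proof (intro allI impI)
  fix e :: real assume "e > 0"
  then have "e / 2 > 0" by simp
  with assms(2,3) have "\<forall>\<^sub>F n in sequentially. \<exists>F\<in>sets (M n). E n \<inter> space (M n) \<subseteq> F \<and> measure (M n) F < e / 2"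
    and "\<forall>\<^sub>F n in sequentially. \<exists>F\<in>sets (M n). E' n \<inter> space (M n) \<subseteq> F \<and> measure (M n) F < e / 2"
    unfolding vanishing_def by blast+
  then show "\<forall>\<^sub>F n in sequentially. \<exists>F\<in>sets (M n). (E n \<union> E' n) \<inter> space (M n) \<subseteq> F \<and> measure (M n) F < e"
  proof eventually_elim
    case (elim n)
    then obtain F F' where F: "F \<in> sets (M n)" "F' \<in> sets (M n)"
        "E n \<inter> space (M n) \<subseteq> F" "E' n \<inter> space (M n) \<subseteq> F'"
        "measure (M n) F < e / 2" "measure (M n) F' < e / 2"
      by blast
    interpret prob_space "M n" by (rule prob)
    have "measure (M n) (F \<union> F') \<le> measure (M n) F + measure (M n) F'"
      using F by (intro measure_Un_le)
    with F have "measure (M n) (F \<union> F') < e" by linarith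
    then show ?case using F by (intro bexI[of _ "F \<union> F'"]) auto
  qed
qed

lemma vanishing_measure_tendsto_0:
  assumes prob: "\<And>n. prob_space (M n)" and "vanishing M E"
  shows "(\<lambda>n. measure (M n) (E n \<inter> space (M n))) \<longlonglongrightarrow> 0"
proof (rule tendstoI)
  fix e :: real assume "e > 0"
  with assms(2) have "\<forall>\<^sub>F n in sequentially. \<exists>F\<in>sets (M n). E n \<inter> space (M n) \<subseteq> F \<and> measure (M n) F < e"
    unfolding vanishing_def by blast
  then show "\<forall>\<^sub>F n in sequentially. dist (measure (M n) (E n \<inter> space (M n))) 0 < e"
  proof eventually_elim
    case (elim n)
    interpret prob_space "M n" by (rule prob)
    from elim obtain F where "F \<in> sets (M n)" "E n \<inter> space (M n) \<subseteq> F" "measure (M n) F < e" by blast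
    then have "measure (M n) (E n \<inter> space (M n)) < e"
      using finite_measure_mono[of "E n \<inter> space (M n)" F] by linarith
    then show ?case by simp
  qed
qed

lemma measure_tendsto_0_vanishing:
  assumes "\<And>n. E n \<inter> space (M n) \<in> sets (M n)"
    and "(\<lambda>n. measure (M n) (E n \<inter> space (M n))) \<longlonglongrightarrow> 0"
  shows "vanishing M E"
  unfolding vanishing_def
proof (intro allI impI)
  fix e :: real assume "e > 0"
  with assms(2) have "\<forall>\<^sub>F n in sequentially. measure (M n) (E n \<inter> space (M n)) < e"
    by (rule order_tendstoD)
  then show "\<forall>\<^sub>F n in sequentially. \<exists>F\<in>sets (M n). E n \<inter> space (M n) \<subseteq> F \<and> measure (M n) F < e"
    by eventually_elim (use assms(1) in blast)
qed

lemma vanishing_converges_in_probability: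
  fixes Z :: "nat \<Rightarrow> 'w \<Rightarrow> 'b::euclidean_space"
  assumes "converges_in_probability M Z z" "e > 0"
  shows "vanishing M (\<lambda>n. {\<omega>. dist (Z n \<omega>) z > e})"
proof (rule measure_tendsto_0_vanishing)
  have *: "{\<omega>. dist (Z n \<omega>) z > e} \<inter> space (M n) = {\<omega> \<in> space (M n). dist (Z n \<omega>) z > e}" for n
    by auto
  have [measurable]: "Z n \<in> borel_measurable (M n)" for n
    using assms(1) by (simp add: converges_in_probability_def)
  show "{\<omega>. dist (Z n \<omega>) z > e} \<inter> space (M n) \<in> sets (M n)" for n
    unfolding * by measurable
  show "(\<lambda>n. measure (M n) ({\<omega>. dist (Z n \<omega>) z > e} \<inter> space (M n))) \<longlonglongrightarrow> 0"
    unfolding * using assms by (simp add: converges_in_probability_def)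
qed

lemma vanishing_outside_open:
  fixes Z :: "nat \<Rightarrow> 'w \<Rightarrow> 'b::euclidean_space"
  assumes "converges_in_probability M Z z" "open U" "z \<in> U"
  shows "vanishing M (\<lambda>n. {\<omega>. Z n \<omega> \<notin> U})"
proof -
  obtain e where "e > 0" "cball z e \<subseteq> U"
    using assms open_contains_cball by blast
  then have "{\<omega>. Z n \<omega> \<notin> U} \<subseteq> {\<omega>. dist (Z n \<omega>) z > e}" for n
    by (auto simp: subset_iff dist_commute not_less[symmetric])
  then show ?thesis
    by (intro vanishing_subset[OF vanishing_converges_in_probability[OF assms(1) \<open>e > 0\<close>]] always_eventually)
      blast
qed

section \<open>Tightness of weakly convergent sequences\<close>

text \<open>The tail events decrease to the empty set, so continuity from above applies.\<close>

lemma tight_tail: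
  fixes \<mu> :: "'b::euclidean_space measure"
  assumes "prob_space \<mu>" "sets \<mu> = sets borel" "e > 0"
  obtains K where "K > 0" "measure \<mu> {x. norm x > K} < e"
proof -
  interpret prob_space \<mu> by fact
  have "(\<lambda>k. measure \<mu> {x. norm x > real k}) \<longlonglongrightarrow> measure \<mu> (\<Inter>k. {x. norm x > real k})"
  proof (rule finite_Lim_measure_decseq)
    have "{x :: 'b. norm x > real k} \<in> sets borel" for k by measurable
    then show "range (\<lambda>k. {x. norm x > real k}) \<subseteq> sets \<mu>"
      unfolding assms(2) by blast
    show "decseq (\<lambda>k. {x :: 'b. norm x > real k})"
      by (rule decseq_SucI) auto
  qed
  moreover have "\<exists>k. \<not> norm x > real k" for x :: 'b
    by (meson reals_Archimedean2 less_asym)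
  then have "(\<Inter>k. {x :: 'b. norm x > real k}) = {}"
    by (auto simp: set_eq_iff)
  ultimately have "(\<lambda>k. measure \<mu> {x. norm x > real k}) \<longlonglongrightarrow> 0" by simp
  then have "\<forall>\<^sub>F k in sequentially. measure \<mu> {x. norm x > real k} < e"
    using assms(3) by (rule order_tendstoD)
  then have "\<forall>\<^sub>F k in sequentially. k > 0 \<and> measure \<mu> {x. norm x > real k} < e"
    using eventually_gt_at_top by (rule eventually_elim2) blast
  then obtain k :: nat where "k > 0" "measure \<mu> {x. norm x > real k} < e"
    using eventually_happens'[OF sequentially_bot] by blast
  then show ?thesis using that[of "real k"] by simp
qed

text \<open>Weak convergence controls integrals of continuous functions only. A ramp rising from 0
  at norm \<open>K\<close> to 1 at norm \<open>K + 1\<close> lies between the two tail indicators,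
  so the bound for the limit at level \<open>K\<close> passes to \<open>Z n\<close> at level
  \<open>K + 1\<close>.\<close>

lemma converges_in_distribution_tight:
  assumes prob: "\<And>n. prob_space (M n)"
    and conv: "converges_in_distribution M Z \<mu>" and \<mu>: "prob_space \<mu>" "sets \<mu> = sets borel"
    and "e > 0"
  obtains K where "K > 0"
    "\<forall>\<^sub>F n in sequentially. measure (M n) {\<omega> \<in> space (M n). norm (Z n \<omega>) > K} < e"
proof -
  obtain K where K: "K > 0" "measure \<mu> {x. norm x > K} < e"
    using tight_tail[OF \<mu> \<open>e > 0\<close>] .
  have Z [measurable]: "Z n \<in> borel_measurable (M n)" for n
    using conv by (simp add: converges_in_distribution_def)
  define f where "f x = max 0 (min 1 (norm x - K))" for x :: 'b
  have f: "continuous_on UNIV f" "bounded (range f)" "0 \<le> f x" "f x \<le> 1" for x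
  proof -
    show "continuous_on UNIV f" unfolding f_def by (intro continuous_intros)
    show "bounded (range f)" by (rule boundedI[of _ 1]) (auto simp: f_def)
  qed (auto simp: f_def)
  have [measurable]: "f \<in> borel_measurable borel"
    using f(1) by (rule borel_measurable_continuous_onI)
  have le: "(\<integral>x. f x \<partial>\<mu>) < e"
  proof -
    interpret prob_space \<mu> by fact
    have S: "{x. norm x > K} \<in> sets \<mu>" unfolding \<mu>(2) by measurable
    have "f \<in> borel_measurable \<mu>"
      by (subst measurable_cong_sets[OF \<mu>(2) refl]) measurable
    then have "integrable \<mu> f"
      using f(3,4) by (intro integrable_const_bound[of _ 1]) auto
    moreover have "integrable \<mu> (indicator {x. norm x > K} :: 'b \<Rightarrow> real)"
      using S by (intro integrable_real_indicator) (auto simp: emeasure_eq_measure)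
    ultimately have "(\<integral>x. f x \<partial>\<mu>) \<le> (\<integral>x. indicator {x. norm x > K} x \<partial>\<mu>)"
      by (rule integral_mono) (auto simp: f_def indicator_def)
    then show ?thesis using S K by simp
  qed
  have "(\<lambda>n. \<integral>\<omega>. f (Z n \<omega>) \<partial>M n) \<longlonglongrightarrow> (\<integral>x. f x \<partial>\<mu>)"
    using conv f unfolding converges_in_distribution_def by blast
  then have "\<forall>\<^sub>F n in sequentially. (\<integral>\<omega>. f (Z n \<omega>) \<partial>M n) < e"
    using le by (rule order_tendstoD)
  then have "\<forall>\<^sub>F n in sequentially. measure (M n) {\<omega> \<in> space (M n). norm (Z n \<omega>) > K + 1} < e"
  proof eventually_elim
    case (elim n)
    interpret prob_space "M n" by (rule prob)
    let ?S = "{\<omega> \<in> space (M n). norm (Z n \<omega>) > K + 1}"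
    have S: "?S \<in> sets (M n)" by measurable
    have "measure (M n) ?S = (\<integral>\<omega>. indicator ?S \<omega> \<partial>M n)"
      using S by simp
    also have "\<dots> \<le> (\<integral>\<omega>. f (Z n \<omega>) \<partial>M n)"
    proof (rule integral_mono)
      show "integrable (M n) (indicator ?S :: _ \<Rightarrow> real)"
        using S by (intro integrable_real_indicator) (auto simp: emeasure_eq_measure)
      show "integrable (M n) (\<lambda>\<omega>. f (Z n \<omega>))"
        using f(3,4) by (intro integrable_const_bound[of _ 1]) auto
    qed (auto simp: f_def indicator_def)
    finally show ?case using elim by linarith
  qed
  then show ?thesis using that[of "K + 1"] K(1) by simp
qed

text \<open>Localization: tightness makes the part with large \<open>Z n\<close> cost less than
  \<open>e / 2\<close>, so estimates that are uniform on bounded sets suffice.\<close>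

lemma vanishing_tightI:
  assumes prob: "\<And>n. prob_space (M n)"
    and conv: "converges_in_distribution M Z \<mu>" and \<mu>: "prob_space \<mu>" "sets \<mu> = sets borel"
    and *: "\<And>K. K > 0 \<Longrightarrow> vanishing M (\<lambda>n. E n \<inter> {\<omega>. norm (Z n \<omega>) \<le> K})"
  shows "vanishing M E"
  unfolding vanishing_def
proof (intro allI impI)
  fix e :: real assume "e > 0"
  then have "e / 2 > 0" by simp
  have Z [measurable]: "Z n \<in> borel_measurable (M n)" for n
    using conv by (simp add: converges_in_distribution_def)
  obtain K where K: "K > 0"
    "\<forall>\<^sub>F n in sequentially. measure (M n) {\<omega> \<in> space (M n). norm (Z n \<omega>) > K} < e / 2"
    using converges_in_distribution_tight[OF prob conv \<mu> \<open>e / 2 > 0\<close>] .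
  have "\<forall>\<^sub>F n in sequentially. \<exists>F\<in>sets (M n).
      E n \<inter> {\<omega>. norm (Z n \<omega>) \<le> K} \<inter> space (M n) \<subseteq> F \<and> measure (M n) F < e / 2"
    using *[OF K(1)] \<open>e / 2 > 0\<close> unfolding vanishing_def by blast
  with K(2) show "\<forall>\<^sub>F n in sequentially. \<exists>F\<in>sets (M n). E n \<inter> space (M n) \<subseteq> F \<and> measure (M n) F < e"
  proof eventually_elim
    case (elim n)
    let ?T = "{\<omega> \<in> space (M n). norm (Z n \<omega>) > K}"
    obtain F where F: "F \<in> sets (M n)"
        "E n \<inter> {\<omega>. norm (Z n \<omega>) \<le> K} \<inter> space (M n) \<subseteq> F" "measure (M n) F < e / 2"
      using elim by blast
    interpret prob_space "M n" by (rule prob)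
    have T: "?T \<in> sets (M n)" by measurable
    have "measure (M n) (?T \<union> F) \<le> measure (M n) ?T + measure (M n) F"
      using F T by (intro measure_Un_le)
    with F elim have "measure (M n) (?T \<union> F) < e" by linarith
    then show ?case using F T by (intro bexI[of _ "?T \<union> F"]) auto
  qed
qed

section \<open>Slutsky's lemma and random matrices\<close>

text \<open>The integrals of \<open>f (g (Z n \<omega>))\<close> converge by continuous mapping.
  Replacing \<open>g (Z n \<omega>)\<close> by \<open>Z' n \<omega>\<close> changes them by a null
  sequence, because \<open>f\<close> is bounded, and uniformly continuous on the bounded sets to
  which tightness confines the argument.\<close>

lemma slutsky_continuous_mapping:
  fixes Z :: "nat \<Rightarrow> 'w \<Rightarrow> 'b::euclidean_space" and Z' :: "nat \<Rightarrow> 'w \<Rightarrow> 'c::euclidean_space"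
  assumes prob: "\<And>n. prob_space (M n)"
    and conv: "converges_in_distribution M Z \<mu>" and \<mu>: "prob_space \<mu>" "sets \<mu> = sets borel"
    and g: "continuous_on UNIV g"
    and Z': "\<And>n. Z' n \<in> borel_measurable (M n)"
    and close: "\<And>e. e > 0 \<Longrightarrow> vanishing M (\<lambda>n. {\<omega>. dist (Z' n \<omega>) (g (Z n \<omega>)) > e})"
  shows "converges_in_distribution M Z' (distr \<mu> borel g)"
  unfolding converges_in_distribution_def
proof (intro conjI allI impI)
  show "Z' n \<in> borel_measurable (M n)" for n by (rule Z')
  note Z'[measurable]
  have Z [measurable]: "Z n \<in> borel_measurable (M n)" for n
    using conv by (simp add: converges_in_distribution_def)
  have g_meas [measurable]: "g \<in> borel_measurable borel"
    using g by (rule borel_measurable_continuous_onI)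
  fix f :: "'c \<Rightarrow> real" assume "continuous_on UNIV f \<and> bounded (range f)"
  then have f: "continuous_on UNIV f" "bounded (range f)" by auto
  then have f_meas [measurable]: "f \<in> borel_measurable borel"
    by (intro borel_measurable_continuous_onI)
  obtain C where C: "C > 0" "\<And>x. norm (f x) \<le> C"
    using f(2) unfolding bounded_pos by auto
  have "(\<lambda>n. \<integral>\<omega>. f (g (Z n \<omega>)) \<partial>M n) \<longlonglongrightarrow> (\<integral>x. f (g x) \<partial>\<mu>)"
  proof -
    have "continuous_on UNIV (\<lambda>x. f (g x))"
      using continuous_on_compose2[OF f(1) g] by simp
    moreover have "bounded (range (\<lambda>x. f (g x)))"
      using f(2) by (rule bounded_subset) auto
    ultimately show ?thesis
      using conv[unfolded converges_in_distribution_def] by blast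
  qed
  moreover have "(\<integral>x. f x \<partial>distr \<mu> borel g) = (\<integral>x. f (g x) \<partial>\<mu>)"
  proof (rule integral_distr)
    show "g \<in> measurable \<mu> borel"
      using g_meas by (simp only: measurable_cong_sets[OF \<mu>(2) refl])
  qed (rule f_meas)
  moreover have "(\<lambda>n. (\<integral>\<omega>. f (Z' n \<omega>) \<partial>M n) - (\<integral>\<omega>. f (g (Z n \<omega>)) \<partial>M n)) \<longlonglongrightarrow> 0"
  proof (rule tendstoI)
    fix e :: real assume "e > 0"
    have "vanishing M (\<lambda>n. {\<omega>. \<bar>f (Z' n \<omega>) - f (g (Z n \<omega>))\<bar> > e / 2})"
    proof (rule vanishing_tightI[OF prob conv \<mu>])
      fix K :: real
      have "compact (g ` cball 0 K)"
        using g by (intro compact_continuous_image continuous_on_subset[OF g]) auto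
      then have "bounded (g ` cball 0 K)" by (rule compact_imp_bounded)
      then obtain R where "\<forall>x\<in>cball 0 K. norm (g x) \<le> R"
        unfolding bounded_iff by auto
      then have R: "norm (g x) \<le> R" if "norm x \<le> K" for x
        using that by simp
      \<comment> \<open>The extra 1 in the radius leaves room for \<open>Z' n \<omega>\<close>,
        which is within \<open>d' \<le> 1\<close> of a point of norm at most
        \<open>R\<close>.\<close>
      have "uniformly_continuous_on (cball 0 (R + 1)) f"
        using f(1) by (intro compact_uniformly_continuous continuous_on_subset[OF f(1)]) auto
      then obtain d where d: "d > 0"
        "\<And>x y. x \<in> cball 0 (R + 1) \<Longrightarrow> y \<in> cball 0 (R + 1) \<Longrightarrow> dist y x < d \<Longrightarrow> dist (f y) (f x) < e / 2"
        using half_gt_zero[OF \<open>e > 0\<close>] by (rule uniformly_continuous_onE) blast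
      \<comment> \<open>Halving \<open>d\<close> is needed since negating \<open>dist > d'\<close>
        gives only \<open>\<le>\<close>, while uniform continuity asks for a distance strictly below
        \<open>d\<close>.\<close>
      define d' where "d' = min 1 (d / 2)"
      have d': "d' > 0" "d' \<le> 1" "d' < d" using d(1) by (auto simp: d'_def)
      have "dist (Z' n \<omega>) (g (Z n \<omega>)) > d'"
        if "\<bar>f (Z' n \<omega>) - f (g (Z n \<omega>))\<bar> > e / 2" "norm (Z n \<omega>) \<le> K" for n \<omega>
      proof (rule ccontr)
        assume "\<not> ?thesis"
        then have le: "dist (Z' n \<omega>) (g (Z n \<omega>)) \<le> d'" by simp
        have "norm (g (Z n \<omega>)) \<le> R" using R that(2) .
        moreover have "norm (Z' n \<omega>) \<le> norm (g (Z n \<omega>)) + dist (Z' n \<omega>) (g (Z n \<omega>))"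
          by (metis add.commute dist_norm norm_triangle_sub)
        ultimately have "dist (f (Z' n \<omega>)) (f (g (Z n \<omega>))) < e / 2"
          using le d' by (intro d(2)) auto
        with that(1) show False by (simp add: dist_real_def)
      qed
      then show "vanishing M (\<lambda>n. {\<omega>. e / 2 < \<bar>f (Z' n \<omega>) - f (g (Z n \<omega>))\<bar>} \<inter> {\<omega>. norm (Z n \<omega>) \<le> K})"
        by (intro vanishing_subset[OF close[OF d'(1)]] always_eventually) blast
    qed
    \<comment> \<open>The difference of the two values of \<open>f\<close> is at most
      \<open>2 * C\<close> on \<open>F\<close>, so this bound on the measure of \<open>F\<close>
      contributes less than the missing \<open>e / 2\<close>.\<close>
    moreover have "e / (4 * C) > 0" using C \<open>e > 0\<close> by simp
    ultimately have "\<forall>\<^sub>F n in sequentially. \<exists>F\<in>sets (M n).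
        {\<omega>. \<bar>f (Z' n \<omega>) - f (g (Z n \<omega>))\<bar> > e / 2} \<inter> space (M n) \<subseteq> F \<and> measure (M n) F < e / (4 * C)"
      unfolding vanishing_def by blast
    then show "\<forall>\<^sub>F n in sequentially.
        dist ((\<integral>\<omega>. f (Z' n \<omega>) \<partial>M n) - (\<integral>\<omega>. f (g (Z n \<omega>)) \<partial>M n)) 0 < e"
    proof eventually_elim
      case (elim n)
      then obtain F where F: "F \<in> sets (M n)" "measure (M n) F < e / (4 * C)"
        "{\<omega>. \<bar>f (Z' n \<omega>) - f (g (Z n \<omega>))\<bar> > e / 2} \<inter> space (M n) \<subseteq> F"
        by blast
      interpret prob_space "M n" by (rule prob)
      have int: "integrable (M n) (\<lambda>\<omega>. f (Z' n \<omega>))" "integrable (M n) (\<lambda>\<omega>. f (g (Z n \<omega>)))"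
        using C(2) by (auto intro!: integrable_const_bound[of _ C])
      have "norm (\<integral>\<omega>. f (Z' n \<omega>) - f (g (Z n \<omega>)) \<partial>M n) \<le> (\<integral>\<omega>. norm (f (Z' n \<omega>) - f (g (Z n \<omega>))) \<partial>M n)"
        by (rule integral_norm_bound)
      also have "\<dots> \<le> (\<integral>\<omega>. e / 2 + 2 * C * indicator F \<omega> \<partial>M n)"
      proof (intro integral_mono)
        show "integrable (M n) (\<lambda>\<omega>. norm (f (Z' n \<omega>) - f (g (Z n \<omega>))))"
          using int by (intro integrable_norm Bochner_Integration.integrable_diff)
        show "integrable (M n) (\<lambda>\<omega>. e / 2 + 2 * C * indicator F \<omega>)"
          using F by (auto simp: emeasure_eq_measure)
        fix \<omega> assume "\<omega> \<in> space (M n)"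
        have "norm (f (Z' n \<omega>) - f (g (Z n \<omega>))) \<le> C + C"
          by (rule order_trans[OF norm_triangle_ineq4 add_mono[OF C(2) C(2)]])
        then show "norm (f (Z' n \<omega>) - f (g (Z n \<omega>))) \<le> e / 2 + 2 * C * indicator F \<omega>"
        proof (cases "\<omega> \<in> F")
          case False
          with F(3) \<open>\<omega> \<in> space (M n)\<close> have "\<not> \<bar>f (Z' n \<omega>) - f (g (Z n \<omega>))\<bar> > e / 2" by blast
          with False show ?thesis by simp
        qed (use \<open>e > 0\<close> in simp)
      qed
      also have "\<dots> = e / 2 + 2 * C * measure (M n) F"
        using F by (simp add: prob_space emeasure_eq_measure)
      also have "\<dots> < e" using F(2) C(1) by (simp add: field_simps)
      finally show ?case using int by simp
    qed
  qed
  ultimately show "(\<lambda>n. \<integral>\<omega>. f (Z' n \<omega>) \<partial>M n) \<longlonglongrightarrow> (\<integral>x. f x \<partial>distr \<mu> borel g)"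
    using tendsto_add[of "\<lambda>n. (\<integral>\<omega>. f (Z' n \<omega>) \<partial>M n) - (\<integral>\<omega>. f (g (Z n \<omega>)) \<partial>M n)" 0 sequentially
        "\<lambda>n. \<integral>\<omega>. f (g (Z n \<omega>)) \<partial>M n"]
    by simp
qed

text \<open>On a bounded set of values of \<open>Z n\<close>, the error is at most a constant times
  the matrix error, which is negligible; tightness does the rest.\<close>

lemma vanishing_matrix_perturbation:
  fixes Z :: "nat \<Rightarrow> 'w \<Rightarrow> real ^ 'm" and A :: "nat \<Rightarrow> 'w \<Rightarrow> real ^ 'm ^ 'n"
  assumes prob: "\<And>n. prob_space (M n)"
    and conv: "converges_in_distribution M Z \<mu>" and \<mu>: "prob_space \<mu>" "sets \<mu> = sets borel"
    and A: "\<And>e. e > 0 \<Longrightarrow> vanishing M (\<lambda>n. {\<omega>. dist (A n \<omega>) A0 > e})" and "e > 0"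
  shows "vanishing M (\<lambda>n. {\<omega>. dist (A n \<omega> *v Z n \<omega>) (A0 *v Z n \<omega>) > e})"
proof (rule vanishing_tightI[OF prob conv \<mu>])
  fix K :: real assume "K > 0"
  obtain C where C: "C > 0" "\<And>(B :: real ^ 'm ^ 'n) x. norm (B *v x) \<le> norm B * norm x * C"
    using bounded_bilinear.pos_bounded[OF bounded_bilinear_matrix_vector_mult] by blast
  let ?d = "e / (K * C)"
  have d: "?d > 0" using \<open>e > 0\<close> \<open>K > 0\<close> C by simp
  have "dist (A n \<omega>) A0 > ?d"
    if "dist (A n \<omega> *v Z n \<omega>) (A0 *v Z n \<omega>) > e" "norm (Z n \<omega>) \<le> K" for n \<omega>
  proof -
    have "e < norm ((A n \<omega> - A0) *v Z n \<omega>)"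
      using that(1) by (simp add: dist_norm matrix_vector_mult_diff_rdistrib)
    also have "\<dots> \<le> norm (A n \<omega> - A0) * norm (Z n \<omega>) * C" by (rule C)
    also have "\<dots> \<le> norm (A n \<omega> - A0) * K * C"
      using that(2) C(1) \<open>K > 0\<close> by (intro mult_right_mono mult_left_mono) auto
    finally show ?thesis using C \<open>K > 0\<close> by (simp add: dist_norm field_simps)
  qed
  then show "vanishing M (\<lambda>n. {\<omega>. dist (A n \<omega> *v Z n \<omega>) (A0 *v Z n \<omega>) > e} \<inter> {\<omega>. norm (Z n \<omega>) \<le> K})"
    by (intro vanishing_subset[OF A[OF d]] always_eventually) blast
qed

text \<open>A functional \<open>t\<close> of the image is the functional
  \<open>transpose T *v t\<close> of the original vector, so the characterization by linear
  functionals transfers directly, degenerate covariances included.\<close>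

lemma is_multivariate_normal_linear_image:
  fixes T :: "real ^ 'd ^ 'd"
  assumes "is_multivariate_normal m S \<mu>"
  shows "is_multivariate_normal (T *v m) (T ** S ** transpose T) (distr \<mu> borel ((*v) T))"
proof -
  have \<mu>: "prob_space \<mu>" "sets \<mu> = sets borel" and sym: "transpose S = S"
    and psd: "\<And>t. 0 \<le> t \<bullet> (S *v t)"
    and law: "\<And>t. distr \<mu> borel (\<lambda>x. t \<bullet> x) = normal_law (t \<bullet> m) (t \<bullet> (S *v t))"
    using assms unfolding is_multivariate_normal_def by auto
  have "(\<lambda>x. T *v x) \<in> borel_measurable borel"
    by (intro borel_measurable_matrix_vector_mult) auto
  then have T: "(*v) T \<in> borel_measurable \<mu>"
    using measurable_cong_sets[OF \<mu>(2) refl] by blast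
  have adj: "t \<bullet> (T *v x) = (transpose T *v t) \<bullet> x" for t x
    by (simp add: dot_lmul_matrix)
  have form: "t \<bullet> (T ** S ** transpose T *v t) = (transpose T *v t) \<bullet> (S *v (transpose T *v t))" for t
    by (metis adj matrix_vector_mul_assoc)
  have "distr (distr \<mu> borel ((*v) T)) borel (\<lambda>x. t \<bullet> x) =
      normal_law (t \<bullet> (T *v m)) (t \<bullet> (T ** S ** transpose T *v t))" for t
  proof -
    have "distr (distr \<mu> borel ((*v) T)) borel (\<lambda>x. t \<bullet> x) = distr \<mu> borel ((\<lambda>x. t \<bullet> x) \<circ> (*v) T)"
      using T by (intro distr_distr) auto
    also have "(\<lambda>x. t \<bullet> x) \<circ> (*v) T = (\<lambda>x. (transpose T *v t) \<bullet> x)"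
      by (simp only: comp_def adj)
    finally show ?thesis by (simp only: law adj[of t m] form)
  qed
  moreover have "transpose (T ** S ** transpose T) = T ** S ** transpose T"
    by (simp add: matrix_transpose_mul sym matrix_mul_assoc)
  ultimately show ?thesis
    unfolding is_multivariate_normal_def form
    using prob_space.prob_space_distr[OF \<mu>(1) T] psd by simp
qed

section \<open>Asymptotics of the oracle Hodges' estimator\<close>

text \<open>If the scaled error is at most \<open>K\<close>, each component of \<open>h\<close> is
  within \<open>K / sqrt n\<close> of that of \<open>\<beta>\<close>. This is eventually below every
  threshold when \<open>\<beta> $ j = c $ j\<close>; otherwise the fixed gap eventually exceeds
  threshold plus error. Having \<open>h\<close> quantified inside gives one \<open>n\<close> for all
  outcomes.\<close>

lemma active_set_eventually:
  fixes h \<beta> c :: "real ^ 'd" and a :: "nat \<Rightarrow> real ^ 'd"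
  assumes a_max: "(\<lambda>n. Max (range (\<lambda>j. a n $ j))) \<longlonglongrightarrow> 0"
    and a_min: "filterlim (\<lambda>n. sqrt (real n) * Min (range (\<lambda>j. a n $ j))) at_top sequentially"
  shows "\<forall>\<^sub>F n in sequentially. \<forall>h. norm (sqrt (real n) *\<^sub>R (h - \<beta>)) \<le> K \<longrightarrow>
    active_set h c (a n) = {j. \<beta> $ j \<noteq> c $ j}"
proof -
  have "(\<lambda>n. K / sqrt (real n)) \<longlonglongrightarrow> 0"
    by (intro real_tendsto_divide_at_top[OF tendsto_const]
        filterlim_compose[OF sqrt_at_top filterlim_real_sequentially])
  then have lim: "(\<lambda>n. Max (range (\<lambda>j. a n $ j)) + K / sqrt (real n)) \<longlonglongrightarrow> 0"
    using tendsto_add[OF a_max] by fastforce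
  have sep: "\<forall>\<^sub>F n in sequentially. Max (range (\<lambda>j. a n $ j)) + K / sqrt (real n) < \<bar>\<beta> $ j - c $ j\<bar>"
    if "\<beta> $ j \<noteq> c $ j" for j
    using that by (intro order_tendstoD(2)[OF lim]) simp
  have "\<forall>\<^sub>F n in sequentially. \<forall>j. \<beta> $ j \<noteq> c $ j \<longrightarrow>
      Max (range (\<lambda>j. a n $ j)) + K / sqrt (real n) < \<bar>\<beta> $ j - c $ j\<bar>"
  proof (rule eventually_all_finite)
    fix j
    show "\<forall>\<^sub>F n in sequentially. \<beta> $ j \<noteq> c $ j \<longrightarrow>
      Max (range (\<lambda>j. a n $ j)) + K / sqrt (real n) < \<bar>\<beta> $ j - c $ j\<bar>"
      using sep[of j] by (cases "\<beta> $ j = c $ j") simp_all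
  qed
  moreover have "\<forall>\<^sub>F n in sequentially. K \<le> sqrt (real n) * Min (range (\<lambda>j. a n $ j))"
    using a_min unfolding filterlim_at_top by blast
  moreover have "\<forall>\<^sub>F n in sequentially. (n :: nat) > 0" by (rule eventually_gt_at_top)
  ultimately show ?thesis
  proof eventually_elim
    case (elim n)
    have s: "sqrt (real n) > 0" using elim(3) by simp
    show ?case
    proof (intro allI impI set_eqI)
      fix h j assume "norm (sqrt (real n) *\<^sub>R (h - \<beta>)) \<le> K"
      then have "\<bar>(sqrt (real n) *\<^sub>R (h - \<beta>)) $ j\<bar> \<le> K"
        using component_le_norm_cart order_trans by blast
      then have h: "sqrt (real n) * \<bar>h $ j - \<beta> $ j\<bar> \<le> K"
        by (simp add: abs_mult)
      then have h': "\<bar>h $ j - \<beta> $ j\<bar> \<le> K / sqrt (real n)"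
        using s by (simp add: field_simps)
      have max: "a n $ j \<le> Max (range (\<lambda>j. a n $ j))" and min: "Min (range (\<lambda>j. a n $ j)) \<le> a n $ j"
        by (auto intro: Max_ge Min_le)
      show "j \<in> active_set h c (a n) \<longleftrightarrow> j \<in> {j. \<beta> $ j \<noteq> c $ j}"
      proof (cases "\<beta> $ j = c $ j")
        case True
        have "sqrt (real n) * Min (range (\<lambda>j. a n $ j)) \<le> sqrt (real n) * a n $ j"
          using s min by simp
        with h elim(2) have "sqrt (real n) * \<bar>h $ j - \<beta> $ j\<bar> \<le> sqrt (real n) * a n $ j" by linarith
        with s True show ?thesis by (simp add: active_set_def)
      next
        case False
        then have "Max (range (\<lambda>j. a n $ j)) + K / sqrt (real n) < \<bar>\<beta> $ j - c $ j\<bar>"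
          using elim(1) by blast
        with max h' have "a n $ j < \<bar>h $ j - c $ j\<bar>" by linarith
        with False show ?thesis by (simp add: active_set_def)
      qed
    qed
  qed
qed

section \<open>Gram matrices and positive definiteness of their limit\<close>

lemma gram_select_columns: "gram n (select_columns b x) = block b b (gram n x)"
  by (auto simp: gram_def select_columns_def block_def vec_eq_iff intro: sum.neutral)

lemma transpose_gram: "transpose (gram n x) = gram n x"
  by (simp add: gram_def transpose_def vec_eq_iff mult.commute)

lemma transpose_limit:
  fixes A :: "nat \<Rightarrow> real ^ 'n ^ 'n"
  assumes "A \<longlonglongrightarrow> L" "\<And>n. transpose (A n) = A n"
  shows "transpose L = L"
proof -
  have "A n $ i $ j = A n $ j $ i" for n i j
    by (metis assms(2) transpose_def vec_lambda_beta)
  then have *: "(\<lambda>n. A n $ i $ j) = (\<lambda>n. A n $ j $ i)" for i j by blast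
  have lim: "(\<lambda>n. A n $ i $ j) \<longlonglongrightarrow> L $ i $ j" for i j
    by (intro tendsto_intros assms(1))
  have "L $ i $ j = L $ j $ i" for i j
    using lim[of i j] lim[of j i] unfolding *[of i j] by (rule LIMSEQ_unique)
  then show ?thesis by (simp add: transpose_def vec_eq_iff)
qed

text \<open>The substitution \<open>x = A *v y\<close> carries the form of the inverse to that of
  \<open>A\<close>. Semidefiniteness of the inverse is what a normal limit law supplies for its
  covariance.\<close>

lemma pos_def_of_matrix_inv:
  fixes A :: "real ^ 'n ^ 'n"
  assumes sym: "transpose A = A" and psd: "\<And>x. 0 \<le> x \<bullet> (matrix_inv A *v x)"
    and inv: "invertible A" and "x \<noteq> 0"
  shows "x \<bullet> (A *v x) > 0"
proof (rule pos_semidef_invertible_pos_def[OF sym _ inv \<open>x \<noteq> 0\<close>])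
  fix y
  have "0 \<le> (A *v y) \<bullet> (matrix_inv A *v (A *v y))" by (rule psd)
  also have "\<dots> = y \<bullet> (A *v y)"
    by (simp add: matrix_vector_mul_assoc matrix_inv_left[OF inv] inner_commute)
  finally show "0 \<le> y \<bullet> (A *v y)" .
qed

theorem theorem2p5:
  fixes M :: "nat \<Rightarrow> 'w measure"
    and X :: "nat \<Rightarrow> nat \<Rightarrow> real ^ 'd"
    and Y \<epsilon> :: "nat \<Rightarrow> nat \<Rightarrow> 'w \<Rightarrow> real"
    and \<beta> c :: "real ^ 'd"
    and \<sigma> :: real
    and \<Sigma>X V :: "real ^ 'd ^ 'd"
    and \<beta>hat \<beta>tilde :: "nat \<Rightarrow> 'w \<Rightarrow> real ^ 'd"
    and Vinvhat Vhat :: "nat \<Rightarrow> 'w \<Rightarrow> real ^ 'd ^ 'd"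
    and a :: "nat \<Rightarrow> real ^ 'd"
  assumes prob: "\<And>n. prob_space (M n)"
    and model: "\<And>n i \<omega>. i < n \<Longrightarrow> \<omega> \<in> space (M n) \<Longrightarrow> Y n i \<omega> = X n i \<bullet> \<beta> + \<epsilon> n i \<omega>"
    and error_measurable: "\<And>n i. i < n \<Longrightarrow> \<epsilon> n i \<in> borel_measurable (M n)"
    and error_square_integrable: "\<And>n i. i < n \<Longrightarrow> integrable (M n) (\<lambda>\<omega>. (\<epsilon> n i \<omega>)\<^sup>2)"
    and error_mean: "\<And>n i. i < n \<Longrightarrow> (\<integral>\<omega>. \<epsilon> n i \<omega> \<partial>M n) = 0"
    and error_variance: "\<And>n i k. i < n \<Longrightarrow> k < n \<Longrightarrow>
          covariance (M n) (\<epsilon> n i) (\<epsilon> n k) = (if i = k then \<sigma>\<^sup>2 else 0)"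
    and sigma_pos: "\<sigma> > 0"
    and beta_hat: "\<And>n \<omega>. \<beta>hat n \<omega> = least_squares n (X n) (\<lambda>i. Y n i \<omega>)"
    and design_limit: "(\<lambda>n. (1 / real n) *\<^sub>R gram n (X n)) \<longlonglongrightarrow> \<Sigma>X"
    and design_invertible: "invertible \<Sigma>X"
    and asymptotic_normality:
          "converges_to_normal M (\<lambda>n \<omega>. sqrt (real n) *\<^sub>R (\<beta>hat n \<omega> - \<beta>)) 0 (\<sigma>\<^sup>2 *\<^sub>R matrix_inv \<Sigma>X)"
    and V: "V = (1 / \<sigma>\<^sup>2) *\<^sub>R \<Sigma>X"
    and V_consistent: "converges_in_probability M Vinvhat (matrix_inv V)"
    and V_hat: "\<And>n \<omega>. Vhat n \<omega> = matrix_inv (Vinvhat n \<omega>)"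
    and a_pos: "\<And>n j. n \<ge> 1 \<Longrightarrow> a n $ j > 0"
    and a_max: "(\<lambda>n. Max (range (\<lambda>j. a n $ j))) \<longlonglongrightarrow> 0"
    and a_min: "filterlim (\<lambda>n. sqrt (real n) * Min (range (\<lambda>j. a n $ j))) at_top sequentially"
    and beta_tilde: "\<And>n \<omega>. \<beta>tilde n \<omega> = oracle_hodges (Vhat n \<omega>) (\<beta>hat n \<omega>) c (a n)"
  shows "(\<forall>b :: 'd set. (\<forall>j \<in> - b. \<beta> $ j = c $ j) \<longrightarrow>
            (\<lambda>n. measure (M n) {\<omega> \<in> space (M n). \<forall>j \<in> - b. \<beta>tilde n \<omega> $ j = \<beta> $ j}) \<longlonglongrightarrow> 1) \<and>
         (let b\<beta> = {j. \<beta> $ j \<noteq> c $ j} in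
            \<exists>\<Sigma>b. (\<lambda>n. (1 / real n) *\<^sub>R gram n (select_columns b\<beta> (X n))) \<longlonglongrightarrow> \<Sigma>b \<and>
                 block_invertible b\<beta> \<Sigma>b \<and>
                 converges_to_normal M (\<lambda>n \<omega>. sqrt (real n) *\<^sub>R (\<beta>tilde n \<omega> - \<beta>)) 0
                   (\<sigma>\<^sup>2 *\<^sub>R block_inv b\<beta> \<Sigma>b))"
proof -
  define B where "B = {j. \<beta> $ j \<noteq> c $ j}"
  define Z where "Z n \<omega> = sqrt (real n) *\<^sub>R (\<beta>hat n \<omega> - \<beta>)" for n \<omega>
  \<comment> \<open>Consistency is assumed for the estimator of the inverse of \<open>V\<close>, so
    the oracle map is expressed as a function of that inverse.\<close>
  define \<Phi> where "\<Phi> A = oracle_map B (matrix_inv A)" for A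
  obtain \<mu> where normal: "is_multivariate_normal 0 (\<sigma>\<^sup>2 *\<^sub>R matrix_inv \<Sigma>X) \<mu>"
    and conv: "converges_in_distribution M Z \<mu>"
    using asymptotic_normality unfolding converges_to_normal_def Z_def[abs_def] by blast
  have \<mu>: "prob_space \<mu>" "sets \<mu> = sets borel"
    and psd: "\<And>t. 0 \<le> t \<bullet> ((\<sigma>\<^sup>2 *\<^sub>R matrix_inv \<Sigma>X) *v t)"
    using normal unfolding is_multivariate_normal_def by auto

  \<comment> \<open>Algebra of the limiting matrix \<open>V\<close>\<close>
  have V_inv: "matrix_inv V = \<sigma>\<^sup>2 *\<^sub>R matrix_inv \<Sigma>X"
    using sigma_pos unfolding V
    by (intro matrix_inv_unique) (simp add: scaleR_matrix_mult matrix_inv_left[OF design_invertible])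
  have inv: "invertible V"
    using sigma_pos design_invertible unfolding V by (intro scalar_invertible) auto
  have "transpose \<Sigma>X = \<Sigma>X"
    using design_limit by (rule transpose_limit) (simp add: transpose_scalar transpose_gram)
  then have sym: "transpose V = V" by (simp add: V transpose_scalar)
  have binv: "block_invertible B V"
    using psd sym inv by (intro block_invertible_pos_def pos_def_of_matrix_inv) (auto simp: V_inv)
  have inv': "invertible (matrix_inv V)"
    using matrix_inv_right[OF inv] matrix_inv_left[OF inv] unfolding invertible_def by blast
  have inv_inv: "matrix_inv (matrix_inv V) = V"
    using matrix_inv_right[OF inv] by (rule matrix_inv_unique)

  have Z_meas: "Z n \<in> borel_measurable (M n)" for n
    using conv by (simp add: converges_in_distribution_def)
  have Vhat_meas: "Vhat n \<in> borel_measurable (M n)" for n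
  proof -
    have "Vinvhat n \<in> borel_measurable (M n)"
      using V_consistent by (simp add: converges_in_probability_def)
    then show ?thesis
      using measurable_compose[OF _ borel_measurable_matrix_inv] by (simp add: V_hat[abs_def])
  qed
  \<comment> \<open>The estimator is recovered from \<open>Z n\<close> by undoing the scaling, which
    is possible only for \<open>n > 0\<close>.\<close>
  have \<beta>hat_meas: "\<beta>hat n \<in> borel_measurable (M n)" if "n > 0" for n
  proof -
    have "\<beta>hat n = (\<lambda>\<omega>. (1 / sqrt (real n)) *\<^sub>R Z n \<omega> + \<beta>)"
      using that by (simp add: Z_def fun_eq_iff)
    then show ?thesis using Z_meas[of n] by simp
  qed
  have \<beta>tilde_meas: "\<beta>tilde n \<in> borel_measurable (M n)" if "n > 0" for n
    using borel_measurable_oracle_hodges[OF Vhat_meas \<beta>hat_meas[OF that]] by (simp add: beta_tilde[abs_def])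

  \<comment> \<open>Selection of the true index set and the first claim\<close>
  have active: "vanishing M (\<lambda>n. {\<omega>. active_set (\<beta>hat n \<omega>) c (a n) \<noteq> B})"
  proof (rule vanishing_tightI[OF prob conv \<mu>])
    fix K
    show "vanishing M (\<lambda>n. {\<omega>. active_set (\<beta>hat n \<omega>) c (a n) \<noteq> B} \<inter> {\<omega>. norm (Z n \<omega>) \<le> K})"
    proof (rule vanishing_subset)
      show "vanishing M (\<lambda>n. {})"
        unfolding vanishing_def by (auto intro!: always_eventually exI[of _ "{}"] bexI[of _ "{}"])
      show "\<forall>\<^sub>F n in sequentially. {\<omega>. active_set (\<beta>hat n \<omega>) c (a n) \<noteq> B} \<inter>
          {\<omega>. norm (Z n \<omega>) \<le> K} \<inter> space (M n) \<subseteq> {}"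
        using active_set_eventually[OF a_max a_min, of \<beta> K c]
        by eventually_elim (auto simp: B_def Z_def)
    qed
  qed

  have consistent: "(\<lambda>n. measure (M n) {\<omega> \<in> space (M n). \<forall>j \<in> - b. \<beta>tilde n \<omega> $ j = \<beta> $ j}) \<longlonglongrightarrow> 1"
    if b: "\<forall>j \<in> - b. \<beta> $ j = c $ j" for b
  proof -
    let ?bad = "\<lambda>n. {\<omega>. \<not> (\<forall>j \<in> - b. \<beta>tilde n \<omega> $ j = \<beta> $ j)}"
    have "vanishing M ?bad"
    proof (rule vanishing_subset[OF active], rule always_eventually, intro allI subsetI CollectI notI)
      fix n \<omega> assume \<omega>: "\<omega> \<in> ?bad n \<inter> space (M n)" and "active_set (\<beta>hat n \<omega>) c (a n) = B"
      \<comment> \<open>Since \<open>\<beta>\<close> and \<open>c\<close> agree off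
        \<open>b\<close>, such a \<open>j\<close> lies outside \<open>B\<close> and is therefore
        inactive, so the estimator sets it to \<open>c $ j\<close>.\<close>
      then have "\<beta>tilde n \<omega> $ j = \<beta> $ j" if "j \<in> - b" for j
        using that b oracle_hodges_nth_inactive[of j "\<beta>hat n \<omega>" c "a n"] by (simp add: beta_tilde B_def)
      with \<omega> show False by simp
    qed
    then have "(\<lambda>n. measure (M n) (?bad n \<inter> space (M n))) \<longlonglongrightarrow> 0"
      by (rule vanishing_measure_tendsto_0[OF prob])
    then have "(\<lambda>n. 1 - measure (M n) (?bad n \<inter> space (M n))) \<longlonglongrightarrow> 1 - 0"
      by (intro tendsto_diff tendsto_const)
    moreover have "\<forall>\<^sub>F n in sequentially. 1 - measure (M n) (?bad n \<inter> space (M n)) =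
        measure (M n) {\<omega> \<in> space (M n). \<forall>j \<in> - b. \<beta>tilde n \<omega> $ j = \<beta> $ j}"
      using eventually_gt_at_top[of 0]
    proof eventually_elim
      case (elim n)
      interpret prob_space "M n" by (rule prob)
      have [measurable]: "(\<lambda>\<omega>. \<beta>tilde n \<omega> $ j) \<in> borel_measurable (M n)" for j
        using \<beta>tilde_meas[OF elim] by (rule borel_measurable_vec_nth)
      have "{\<omega> \<in> space (M n). \<forall>j \<in> - b. \<beta>tilde n \<omega> $ j = \<beta> $ j} \<in> sets (M n)"
        by measurable
      moreover have "?bad n \<inter> space (M n) =
          space (M n) - {\<omega> \<in> space (M n). \<forall>j \<in> - b. \<beta>tilde n \<omega> $ j = \<beta> $ j}"
        by auto
      ultimately show ?case using prob_compl by simp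
    qed
    ultimately show ?thesis
      using tendsto_cong by fastforce
  qed

  \<comment> \<open>Convergence in distribution of the scaled error\<close>
  have \<Phi>_cont: "isCont \<Phi> (matrix_inv V)"
    unfolding \<Phi>_def[abs_def]
    by (rule isCont_o2[OF isCont_matrix_inv[OF inv']]) (simp add: inv_inv isCont_oracle_map[OF binv])
  have \<Phi>_close: "vanishing M (\<lambda>n. {\<omega>. dist (\<Phi> (Vinvhat n \<omega>)) (oracle_map B V) > e})" if "e > 0" for e
  proof -
    obtain d where d: "d > 0"
      "\<And>A. dist A (matrix_inv V) < d \<Longrightarrow> dist (\<Phi> A) (\<Phi> (matrix_inv V)) < e"
      using \<Phi>_cont \<open>e > 0\<close> unfolding continuous_at_eps_delta by blast
    have "\<not> dist (\<Phi> (Vinvhat n \<omega>)) (oracle_map B V) > e" if "Vinvhat n \<omega> \<in> ball (matrix_inv V) d" for n \<omega>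
      using d(2)[of "Vinvhat n \<omega>"] that by (simp add: dist_commute \<Phi>_def inv_inv)
    then have "{\<omega>. dist (\<Phi> (Vinvhat n \<omega>)) (oracle_map B V) > e} \<subseteq>
        {\<omega>. Vinvhat n \<omega> \<notin> ball (matrix_inv V) d}" for n
      by blast
    then show ?thesis
      using d(1)
      by (intro vanishing_subset[OF vanishing_outside_open[OF V_consistent open_ball]] always_eventually)
        auto
  qed

  let ?Z' = "\<lambda>n \<omega>. sqrt (real n) *\<^sub>R (\<beta>tilde n \<omega> - \<beta>)"
  have block_inv: "vanishing M (\<lambda>n. {\<omega>. \<not> block_invertible B (Vhat n \<omega>)})"
  proof -
    \<comment> \<open>Inversion is continuous on the open set of invertible matrices, so this is an
      open neighbourhood of \<open>matrix_inv V\<close>, which consistency makes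
      \<open>Vinvhat\<close> hit with probability tending to 1.\<close>
    have "open ({A. invertible A} \<inter> matrix_inv -` {A. block_invertible B A})"
      using continuous_on_open_vimage[OF open_invertible] continuous_on_matrix_inv open_block_invertible
      by (metis Int_commute)
    then have "vanishing M (\<lambda>n. {\<omega>. Vinvhat n \<omega> \<notin>
        {A. invertible A} \<inter> matrix_inv -` {A. block_invertible B A}})"
      using inv' binv by (intro vanishing_outside_open[OF V_consistent]) (auto simp: inv_inv)
    then show ?thesis
      by (rule vanishing_subset) (auto simp: V_hat intro!: always_eventually)
  qed
  have conv': "converges_in_distribution M ?Z' (distr \<mu> borel ((*v) (oracle_map B V)))"
  proof (rule slutsky_continuous_mapping[OF prob conv \<mu>])
    show "continuous_on UNIV ((*v) (oracle_map B V))"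
      by (intro linear_continuous_on) (simp add: linear_conv_bounded_linear[symmetric])
    \<comment> \<open>At \<open>n = 0\<close> the factor \<open>sqrt 0\<close> makes the scaled
      error constantly zero.\<close>
    show "?Z' n \<in> borel_measurable (M n)" for n
      using \<beta>tilde_meas[of n] by (cases "n = 0") auto
    fix e :: real assume "e > 0"
    have "vanishing M (\<lambda>n. {\<omega>. dist (\<Phi> (Vinvhat n \<omega>) *v Z n \<omega>) (oracle_map B V *v Z n \<omega>) > e})"
      using \<Phi>_close \<open>e > 0\<close> by (rule vanishing_matrix_perturbation[OF prob conv \<mu>])
    \<comment> \<open>Three exceptional events: a wrong active set, a singular block of
      \<open>Vhat\<close>, and a random linear map whose value at \<open>Z n\<close> is off by more
      than \<open>e\<close>. Outside them \<open>?Z' n \<omega>\<close> is exactly that random map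
      applied to \<open>Z n \<omega>\<close>.\<close>
    note bad = vanishing_Un[OF prob vanishing_Un[OF prob active block_inv] this]
    show "vanishing M (\<lambda>n. {\<omega>. dist (?Z' n \<omega>) (oracle_map B V *v Z n \<omega>) > e})"
    proof (rule vanishing_subset[OF bad], intro always_eventually allI subsetI, rule ccontr)
      fix n \<omega>
      assume far: "\<omega> \<in> {\<omega>. dist (?Z' n \<omega>) (oracle_map B V *v Z n \<omega>) > e} \<inter> space (M n)"
        and "\<omega> \<notin> {\<omega>. active_set (\<beta>hat n \<omega>) c (a n) \<noteq> B} \<union> {\<omega>. \<not> block_invertible B (Vhat n \<omega>)} \<union>
          {\<omega>. dist (\<Phi> (Vinvhat n \<omega>) *v Z n \<omega>) (oracle_map B V *v Z n \<omega>) > e}"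
      then have good: "active_set (\<beta>hat n \<omega>) c (a n) = B" "block_invertible B (Vhat n \<omega>)"
        "\<not> dist (\<Phi> (Vinvhat n \<omega>) *v Z n \<omega>) (oracle_map B V *v Z n \<omega>) > e"
        by auto
      have "\<beta>tilde n \<omega> - \<beta> = oracle_map B (Vhat n \<omega>) *v (\<beta>hat n \<omega> - \<beta>)"
        unfolding beta_tilde using good(1,2) by (rule oracle_hodges_eq) (simp add: B_def)
      then have "?Z' n \<omega> = \<Phi> (Vinvhat n \<omega>) *v Z n \<omega>"
        by (simp add: \<Phi>_def V_hat Z_def matrix_vector_mult_scaleR)
      with far good(3) show False by simp
    qed
  qed

  \<comment> \<open>Identification of the limit covariance\<close>
  have normal': "is_multivariate_normal 0 (block_inv B V) (distr \<mu> borel ((*v) (oracle_map B V)))"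
    using is_multivariate_normal_linear_image[OF normal, of "oracle_map B V"]
    by (simp only: V_inv[symmetric] oracle_map_covariance[OF sym inv binv] matrix_vector_mult_0_right)
  have \<Sigma>X_eq: "\<Sigma>X = \<sigma>\<^sup>2 *\<^sub>R V" using sigma_pos by (simp add: V)
  have binv_\<Sigma>: "block_inv B \<Sigma>X = (1 / \<sigma>\<^sup>2) *\<^sub>R block_inv B V"
    using sigma_pos unfolding \<Sigma>X_eq by (intro block_inv_scaleR[OF binv]) simp
  have "block_invertible B (block B B \<Sigma>X)"
  proof -
    have "is_block_inverse B \<Sigma>X ((1 / \<sigma>\<^sup>2) *\<^sub>R block_inv B V)"
      using is_block_inverse_block_inv[OF binv] sigma_pos unfolding \<Sigma>X_eq
      by (simp add: is_block_inverse_def block_scaleR scaleR_matrix_mult)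
    then show ?thesis unfolding block_invertible_block by (auto simp: block_invertible_def)
  qed
  moreover have "(\<lambda>n. (1 / real n) *\<^sub>R gram n (select_columns B (X n))) \<longlonglongrightarrow> block B B \<Sigma>X"
  proof -
    have "isCont (block B B) \<Sigma>X"
      by (intro linear_continuous_at) (simp add: linear_block linear_conv_bounded_linear[symmetric])
    then have "(\<lambda>n. block B B ((1 / real n) *\<^sub>R gram n (X n))) \<longlonglongrightarrow> block B B \<Sigma>X"
      using design_limit by (rule isCont_tendsto_compose)
    then show ?thesis by (simp add: gram_select_columns block_scaleR)
  qed
  \<comment> \<open>The factor from \<open>\<Sigma>X = \<sigma>\<^sup>2 *\<^sub>R V\<close> is
    inverted by \<open>block_inv\<close> and cancels. For \<open>B = {}\<close> both sides are zero
    and the limit law is the point mass at 0.\<close>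
  moreover have "\<sigma>\<^sup>2 *\<^sub>R block_inv B (block B B \<Sigma>X) = block_inv B V"
    using sigma_pos by (simp add: block_inv_block binv_\<Sigma>)
  then have "converges_to_normal M ?Z' 0 (\<sigma>\<^sup>2 *\<^sub>R block_inv B (block B B \<Sigma>X))"
    using conv' normal' unfolding converges_to_normal_def by auto
  ultimately show ?thesis
    using consistent unfolding Let_def B_def[symmetric] by blast
qed

end
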